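(* Let $\beta$ be a nonreal number, let $\mu_1<\mu_2<\dots<\mu_{n-1}$ be distinct real numbers, and let $\{\lambda_j\}_{j=1}^{n}$ be a set of complex numbers with $\operatorname{Im}\lambda_j>0$ for $j=1,\dots,n$. Put $\chi_n(\lambda)=\prod_{j=1}^n(\lambda-\lambda_j)$. Then there exists a matrix $\widehat{J}_n$ in the class $\widehat{\mathcal{J}}_n$ with $\operatorname{Im}\widehat{a}_n>0$ and $\widehat{b}_1\widehat b_2\cdots\widehat{b}_n=\beta$ such that the spectrum of $\widehat{J}_n$ is $\{\lambda_1,\dots,\lambda_n\}$ and the spectrum of its leading principal $(n-1)\times(n-1)$ submatrix $\widehat{J}_{n-1}$ is $\{\mu_1,\dots,\mu_{n-1}\}$, if and only if $$(-1)^{n-k}\chi_n(\mu_k)>0\quad\text{and}\quad|\chi_n(\mu_k)+2\operatorname{Re}\beta|\ge2|\beta|,\qquad k=1,\dots,n-1$$ (the first inequality includes the requirement that $\chi_n(\mu_k)$ is real). Moreover, if there are $m$ $(0\le m\le n-1)$ equalities in these conditions (that is, among the inequalities $|\chi_n(\mu_k)+2\operatorname{Re}\beta|\ge2|\beta|$), then there exist exactly $2^{n-m-1}$ matrices in the class $\widehat{\mathcal{J}}_n$ with these spectral data (the spectrum $\{\lambda_j\}$ of the matrix, the spectrum $\{\mu_k\}$ of its leading principal $(n-1)\times(n-1)$ submatrix, and the number $\beta=\widehat b_1\cdots\widehat b_n$).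
   Context: $\widehat{\mathcal{J}}_n$ is the class of complex $n\times n$ matrices $$\widehat{J}_n=\begin{pmatrix} \widehat{c}_1 & \widehat{b}_1 & 0 &\dots& 0 & \overline{\widehat{b}}_n\\ \widehat{b}_1 & \widehat{c}_2 & \widehat{b}_2 &\dots& 0 & 0\\ 0 & \widehat{b}_2 & \widehat{c}_3 &\dots& 0 & 0\\ \vdots&\vdots&\vdots&\ddots&\vdots&\vdots\\ 0&0&0&\dots&\widehat{c}_{n-1}&\widehat{b}_{n-1}\\ \widehat{b}_n&0&0&\dots&\widehat{b}_{n-1}&\widehat{a}_n \end{pmatrix},$$ i.e. the diagonal entries are $\widehat c_1,\dots,\widehat c_{n-1},\widehat a_n$; the $(k,k+1)$ and $(k+1,k)$ entries are $\widehat b_k$ for $k=1,\dots,n-1$; the $(1,n)$ entry is $\overline{\widehat b}_n$ and the $(n,1)$ entry is $\widehat b_n$; all other entries are $0$. Here $\widehat{c}_1,\dots,\widehat{c}_{n-1},\widehat{b}_1,\dots,\widehat{b}_{n-1}\in\mathbb{R}$, and $\widehat{a}_n,\widehat{b}_n\in\mathbb{C}$ with $\widehat{b}_n\ne0$.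
   Formalization: The count 2^{n-m-1} is proved for matrices with b_1,…,b_{n-1}>0, equivalently up to conjugation by diagonal ±1 matrices (over all real signs it is 2^{n-1} times larger); n≥3 is assumed so that entries do not collide, and spectra are counted with multiplicity. *)

theory Defs
  imports
    "HOL-Analysis.Analysis"
    "Jordan_Normal_Form.Char_Poly"
    "Jordan_Normal_Form.DL_Submatrix"
begin

text \<open>
  Matrices are indexed from 0, while the sequences \<open>c\<close> and \<open>b\<close> keep the mathematical indices
  starting at 1.  For \<open>n \<ge> 3\<close> the five cases below do not overlap; for \<open>n = 2\<close> the corner
  entries would coincide with the entries adjacent to the diagonal, so the class is only used
  for \<open>n \<ge> 3\<close>.
\<close>

definition Jhat_mat ::
    "nat \<Rightarrow> (nat \<Rightarrow> real) \<Rightarrow> (nat \<Rightarrow> real) \<Rightarrow> complex \<Rightarrow> complex \<Rightarrow> complex mat" where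
  "Jhat_mat n c b an bn = mat n n (\<lambda>(i, j).
     if i = j then (if i = n - 1 then an else of_real (c (i + 1)))
     else if j = i + 1 then of_real (b (i + 1))
     else if i = j + 1 then of_real (b (j + 1))
     else if i = 0 \<and> j = n - 1 then cnj bn
     else if i = n - 1 \<and> j = 0 then bn
     else 0)"

definition Jhat_class :: "nat \<Rightarrow> complex mat set" where
  "Jhat_class n = {Jhat_mat n c b an bn | c b an bn. bn \<noteq> 0}"

text \<open>The product \<open>b\<^sub>1 \<cdots> b\<^sub>n\<close>, read off from the subdiagonal and the lower left corner.\<close>

definition offdiag_prod :: "nat \<Rightarrow> complex mat \<Rightarrow> complex" where
  "offdiag_prod n J = (\<Prod>k = 1..n - 1. J $$ (k, k - 1)) * J $$ (n - 1, 0)"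

text \<open>The spectrum, with eigenvalues counted according to algebraic multiplicity.\<close>

definition mspectrum :: "complex mat \<Rightarrow> complex multiset" where
  "mspectrum A = proots (char_poly A)"

definition chi :: "nat \<Rightarrow> (nat \<Rightarrow> complex) \<Rightarrow> complex \<Rightarrow> complex" where
  "chi n lam z = (\<Prod>j = 1..n. z - lam j)"

text \<open>
  The matrices of the class with given spectral data.  There is no condition on the imaginary
  part of the last diagonal entry here.
\<close>

definition spectral_matrices ::
    "nat \<Rightarrow> (nat \<Rightarrow> complex) \<Rightarrow> (nat \<Rightarrow> real) \<Rightarrow> complex \<Rightarrow> complex mat set" where
  "spectral_matrices n lam mu \<beta> = {J \<in> Jhat_class n.
     offdiag_prod n J = \<beta> \<and>
     mspectrum J = image_mset lam (mset_set {1..n}) \<and>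
     mspectrum (submatrix J {..<n - 1} {..<n - 1})
       = image_mset (\<lambda>k. of_real (mu k)) (mset_set {1..n - 1})}"

text \<open>
  The signs of \<open>b\<^sub>1, \<dots>, b\<^sub>n\<^sub>-\<^sub>1\<close> are not determined by the spectral data: conjugation by a
  diagonal matrix with entries 1 and -1 preserves the class, both spectra and the product
  \<open>b\<^sub>1 \<cdots> b\<^sub>n\<close>.  Matrices are therefore counted up to such conjugations; equivalently, those
  normalized by \<open>b\<^sub>1, \<dots>, b\<^sub>n\<^sub>-\<^sub>1 > 0\<close> are counted.
\<close>

definition sign_equiv :: "nat \<Rightarrow> complex mat rel" where
  "sign_equiv n = {(A, B). \<exists>s :: nat \<Rightarrow> complex. (\<forall>i < n. s i = 1 \<or> s i = - 1) \<and>
     B = mat n n (\<lambda>(i, j). s i * A $$ (i, j) * s j)}"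

definition Jhat_class_pos :: "nat \<Rightarrow> complex mat set" where
  "Jhat_class_pos n = {Jhat_mat n c b an bn | c b an bn. bn \<noteq> 0 \<and> (\<forall>k \<in> {1..n - 1}. b k > 0)}"

end

theory Submission
  imports Defs
begin

text \<open>
  Put \<open>N = n - 1\<close>. For a matrix \<open>J\<close> of the class let \<open>P\<close> be the characteristic polynomial of the leading
  block \<open>J\<^sub>N\<close>, and let \<open>R\<close> and \<open>Q\<close> be those of \<open>J\<^sub>N\<close> without its last, respectively first, row and
  column. Expanding the determinant gives (\<open>char_poly_Jhat_mat\<close>)

    \<open>\<chi> = (X - a\<^sub>n) P - (b\<^sub>N\<^sup>2 R + |b\<^sub>n|\<^sup>2 Q + 2 Re \<beta>)\<close>.

  At a root \<open>\<mu>\<^sub>k\<close> of \<open>P\<close> put \<open>y\<^sub>k = b\<^sub>N\<^sup>2 R(\<mu>\<^sub>k)\<close> and \<open>z\<^sub>k = |b\<^sub>n|\<^sup>2 Q(\<mu>\<^sub>k)\<close>. Their sum is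
  \<open>- s\<^sub>k\<close> with \<open>s\<^sub>k = \<chi>(\<mu>\<^sub>k) + 2 Re \<beta>\<close>, and their product is \<open>|\<beta>|\<^sup>2\<close>, because \<open>Q R\<close> equals
  \<open>(b\<^sub>1 \<cdots> b\<^sub>N\<^sub>-\<^sub>1)\<^sup>2\<close> where \<open>P\<close> vanishes. So \<open>y\<^sub>k\<close> is a real root of

    \<open>t\<^sup>2 + s\<^sub>k t + |\<beta>|\<^sup>2 = 0\<close>,

  whose coefficients are spectral data; this is \<open>corner_poly_at_root\<close>. A Wronskian argument
  (\<open>jacpoly_wronskian_pos\<close>) shows that \<open>R(\<mu>\<^sub>k)\<close>, and hence \<open>y\<^sub>k\<close>, has the sign of \<open>P'(\<mu>\<^sub>k)\<close>, which is
  \<open>(-1)\<^sup>N\<^sup>-\<^sup>k\<close>. Real roots mean \<open>|s\<^sub>k| \<ge> 2 |\<beta>|\<close>, and since \<open>|Re \<beta>| < |\<beta>|\<close> for nonreal \<open>\<beta>\<close>, the numbers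
  \<open>s\<^sub>k\<close> and \<open>\<chi>(\<mu>\<^sub>k)\<close> then have the same sign, opposite to that of \<open>y\<^sub>k\<close>. These are the stated
  conditions.

  Conversely, let the conditions hold and choose a root \<open>y\<^sub>k\<close> of each quadratic equation. Each has the
  sign \<open>(-1)\<^sup>N\<^sup>-\<^sup>k\<close>, so the polynomial \<open>T\<close> of degree below \<open>N\<close> that interpolates the values \<open>y\<^sub>k\<close> at \<open>\<mu>\<^sub>k\<close>
  alternates in sign. Running the Euclidean algorithm on \<open>P\<close> and \<open>T\<close> produces exactly one
  Jacobi matrix \<open>J\<^sub>N\<close> and one \<open>b\<^sub>N\<close> with all \<open>b\<^sub>i > 0\<close> and \<open>T = b\<^sub>N\<^sup>2 R\<close> (\<open>jacobi_realization\<close>,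
  \<open>jacobi_unique\<close>). The remaining entries are \<open>b\<^sub>n = \<beta> / (b\<^sub>1 \<cdots> b\<^sub>N)\<close> and, from the trace,
  \<open>a\<^sub>n = \<Sum> \<lambda>\<^sub>j - \<Sum> \<mu>\<^sub>k\<close>, whose imaginary part is \<open>\<Sum> Im \<lambda>\<^sub>j > 0\<close>. The characteristic polynomial of
  this matrix and \<open>\<chi>\<close> agree in their two leading coefficients and at the \<open>N\<close> nodes, so they are equal
  (\<open>bordered_poly_eq_iff\<close>).

  Hence the normalized matrices with the given data correspond bijectively to the choices of one root
  of each quadratic (\<open>last_weights_bij_betw\<close>). There are two roots unless \<open>|s\<^sub>k| = 2 |\<beta>|\<close>, which
  gives \<open>2\<^sup>N\<^sup>-\<^sup>m\<close> choices, and every class of matrices up to sign changes contains exactly one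
  normalized matrix (\<open>sign_normalization\<close>, \<open>sign_equiv_pos_eq\<close>).
\<close>

(* Leaves smult to mean the scalar multiplication of polynomials. *)
hide_const (open) Module.smult

section \<open>Tridiagonal determinants with and without corner entries\<close>

text \<open>
  The continuant of a symmetric tridiagonal matrix with diagonal \<open>d\<^sub>1, d\<^sub>2, \<dots>\<close> and off-diagonal
  \<open>e\<^sub>1, e\<^sub>2, \<dots>\<close>. The ring is arbitrary because the entries are real polynomials
  in the inverse problem and complex polynomials in the matrices whose determinant is taken.
\<close>
fun contin :: "(nat \<Rightarrow> 'a::comm_ring_1) \<Rightarrow> (nat \<Rightarrow> 'a) \<Rightarrow> nat \<Rightarrow> 'a" where
  "contin d e 0 = 1"
| "contin d e (Suc 0) = d 1"
| "contin d e (Suc (Suc k)) = d (k + 2) * contin d e (Suc k) - e (k + 1) ^ 2 * contin d e k"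

definition trid :: "(nat \<Rightarrow> 'a::zero) \<Rightarrow> (nat \<Rightarrow> 'a) \<Rightarrow> nat \<Rightarrow> 'a mat" where
  "trid d e m = mat m m (\<lambda>(i, j).
     if i = j then d (i + 1) else if j = i + 1 then e (i + 1) else if i = j + 1 then e (j + 1) else 0)"

lemma mat_delete_mat:
  assumes "i \<le> m" "j \<le> k"
  shows "mat_delete (mat (Suc m) (Suc k) f) i j =
    mat m k (\<lambda>(a, b). f (if a < i then a else Suc a, if b < j then b else Suc b))"
  unfolding mat_delete_def using assms by (intro eq_matI) auto

text \<open>
  Expansion along the last column meets the two entries \<open>e\<^sub>m\<^sub>-\<^sub>1\<close> and \<open>d\<^sub>m\<close>; the minor of the former has
  a last row with the single nonzero entry \<open>e\<^sub>m\<^sub>-\<^sub>1\<close>. This is the recurrence of the continuant.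
\<close>
lemma det_trid: "det (trid d e m) = contin d e m"
proof (induction d e m rule: contin.induct)
  case (1 d e)
  show ?case by (simp add: trid_def)
next
  case (2 d e)
  show ?case by (simp add: trid_def det_single)
next
  case (3 d e k)
  let ?A = "trid d e (Suc (Suc k))"
  have A: "?A \<in> carrier_mat (Suc (Suc k)) (Suc (Suc k))" by (simp add: trid_def)
  have last: "mat_delete ?A (Suc k) (Suc k) = trid d e (Suc k)"
    unfolding trid_def by (subst mat_delete_mat) (auto intro!: eq_matI)
  let ?B = "mat_delete ?A k (Suc k)"
  have B: "?B \<in> carrier_mat (Suc k) (Suc k)" using mat_delete_carrier[OF A] by simp
  have "det ?B = (\<Sum>j<Suc k. ?B $$ (k, j) * cofactor ?B k j)"
    using laplace_expansion_row[OF B, of k] by simp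
  also have "\<dots> = ?B $$ (k, k) * cofactor ?B k k"
  proof -
    have "?B $$ (k, j) = 0" if "j < k" for j
      using that unfolding trid_def by (subst mat_delete_mat) auto
    thus ?thesis by simp
  qed
  also have "?B $$ (k, k) = e (k + 1)"
    unfolding trid_def by (subst mat_delete_mat) auto
  also have "mat_delete ?B k k = trid d e k"
    unfolding trid_def by (subst mat_delete_mat, simp, simp, subst mat_delete_mat) (auto intro!: eq_matI)
  hence "cofactor ?B k k = contin d e k" using 3 by (simp add: cofactor_def)
  finally have detB: "det ?B = e (k + 1) * contin d e k" .
  have "det ?A = (\<Sum>i<Suc (Suc k). ?A $$ (i, Suc k) * cofactor ?A i (Suc k))"
    using laplace_expansion_column[OF A, of "Suc k"] by simp
  also have "\<dots> = ?A $$ (k, Suc k) * cofactor ?A k (Suc k) + ?A $$ (Suc k, Suc k) * cofactor ?A (Suc k) (Suc k)"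
  proof -
    have "?A $$ (i, Suc k) = 0" if "i < k" for i
      using that by (simp add: trid_def)
    thus ?thesis by simp
  qed
  also have "?A $$ (k, Suc k) = e (k + 1)" by (simp add: trid_def)
  also have "?A $$ (Suc k, Suc k) = d (k + 2)" by (simp add: trid_def)
  also have "cofactor ?A k (Suc k) = - (e (k + 1) * contin d e k)" by (simp add: cofactor_def detB)
  also have "cofactor ?A (Suc k) (Suc k) = contin d e (Suc k)" using 3 by (simp add: cofactor_def last)
  finally show ?case by (simp add: power2_eq_square algebra_simps)
qed

definition ptrid :: "(nat \<Rightarrow> 'a::zero) \<Rightarrow> (nat \<Rightarrow> 'a) \<Rightarrow> 'a \<Rightarrow> 'a \<Rightarrow> nat \<Rightarrow> 'a mat" where
  "ptrid d e x y n = mat n n (\<lambda>(i, j).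
     if i = j then d (i + 1) else if j = i + 1 then e (i + 1) else if i = j + 1 then e (j + 1)
     else if i = 0 \<and> j = n - 1 then x else if i = n - 1 \<and> j = 0 then y else 0)"

lemma det_upper_triangular_mat:
  assumes "\<And>i j. j < i \<Longrightarrow> i < n \<Longrightarrow> f (i, j) = 0"
  shows "det (mat n n f :: 'a::comm_ring_1 mat) = (\<Prod>i<n. f (i, i))"
proof -
  have "det (mat n n f) = prod_list (diag_mat (mat n n f))"
    by (rule det_upper_triangular[where n = n]) (auto intro!: upper_triangularI simp: assms)
  also have "\<dots> = (\<Prod>i<n. f (i, i))"
    by (auto simp: prod_list_diag_prod atLeast0LessThan intro!: prod.cong)
  finally show ?thesis .
qed

lemma det_lower_triangular_mat:
  assumes "\<And>i j. i < j \<Longrightarrow> j < n \<Longrightarrow> f (i, j) = 0"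
  shows "det (mat n n f :: 'a::comm_ring_1 mat) = (\<Prod>i<n. f (i, i))"
proof -
  have "det (mat n n f) = prod_list (diag_mat (mat n n f))"
    by (rule det_lower_triangular[where n = n]) (auto simp: assms)
  also have "\<dots> = (\<Prod>i<n. f (i, i))"
    by (auto simp: prod_list_diag_prod atLeast0LessThan intro!: prod.cong)
  finally show ?thesis .
qed

lemma sum_only_first_last:
  fixes f :: "nat \<Rightarrow> 'a::comm_monoid_add"
  assumes "\<And>i. 0 < i \<Longrightarrow> i < m \<Longrightarrow> f i = 0" "0 < m"
  shows "(\<Sum>i<Suc m. f i) = f 0 + f m"
proof -
  have "(\<Sum>i<Suc m. f i) = (\<Sum>i\<in>{0, m}. f i)"
    using assms by (intro sum.mono_neutral_right) auto
  thus ?thesis using assms(2) by simp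
qed

text \<open>
  The last column has three nonzero entries. Deleting the row of either off-diagonal one leaves a
  matrix with two nonzero entries in its first column or last row, and each of these has a minor
  that is either triangular, which yields the product of all \<open>e\<^sub>i\<close>, or again tridiagonal.
  The assumption \<open>1 \<le> M\<close> keeps the corners away from the off-diagonals.
\<close>
lemma det_ptrid:
  fixes d e :: "nat \<Rightarrow> 'a::comm_ring_1"
  assumes "1 \<le> M"
  shows "det (ptrid d e x y (Suc (Suc M))) =
    contin d e (Suc (Suc M)) - x * y * contin (\<lambda>i. d (Suc i)) (\<lambda>i. e (Suc i)) M
    + (-1) ^ Suc M * (x + y) * (\<Prod>i = 1..Suc M. e i)"
proof -
  let ?A = "ptrid d e x y (Suc (Suc M))"
  have A: "?A \<in> carrier_mat (Suc (Suc M)) (Suc (Suc M))" by (simp add: ptrid_def)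
  let ?f = "\<lambda>(i, j).
     if i = j then d (i + 1) else if j = i + 1 then e (i + 1) else if i = j + 1 then e (j + 1)
     else if i = 0 \<and> j = Suc M then x else if i = Suc M \<and> j = 0 then y else 0"
  have A_mat: "?A = mat (Suc (Suc M)) (Suc (Suc M)) ?f" by (simp only: ptrid_def diff_Suc_1)
  have shift: "(\<Prod>i<M. e (Suc (Suc i))) * e (Suc 0) = (\<Prod>i = 1..Suc M. e i)"
    using prod.atLeast1_atMost_eq[of e "Suc M"] by (simp add: prod.lessThan_Suc_shift mult.commute del: prod.lessThan_Suc)
  have shift': "(\<Prod>i<M. e (Suc i)) * e (Suc M) = (\<Prod>i = 1..Suc M. e i)"
    using prod.atLeast1_atMost_eq[of e "Suc M"] by simp
  have last: "mat_delete ?A (Suc M) (Suc M) = trid d e (Suc M)"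
    unfolding A_mat trid_def using assms by (subst mat_delete_mat) (auto intro!: eq_matI)
  \<comment> \<open>The minor of the upper right corner.\<close>
  let ?B = "mat_delete ?A 0 (Suc M)"
  have B: "?B \<in> carrier_mat (Suc M) (Suc M)" using mat_delete_carrier[OF A] by simp
  have B_mat: "?B = mat (Suc M) (Suc M) (\<lambda>(a, b). ?f (Suc a, b))"
    unfolding A_mat by (subst mat_delete_mat) (auto intro!: cong_mat)
  have "det ?B = (\<Sum>i<Suc M. ?B $$ (i, 0) * cofactor ?B i 0)"
    using laplace_expansion_column[OF B, of 0] by simp
  also have "\<dots> = ?B $$ (0, 0) * cofactor ?B 0 0 + ?B $$ (M, 0) * cofactor ?B M 0"
    using assms by (intro sum_only_first_last) (auto simp: B_mat)
  also have "?B $$ (0, 0) = e 1" by (simp add: B_mat)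
  also have "?B $$ (M, 0) = y" using assms by (simp add: B_mat)
  also have "mat_delete ?B 0 0 = mat M M (\<lambda>(a, b). ?f (Suc (Suc a), Suc b))"
    unfolding B_mat by (subst mat_delete_mat) (auto intro!: cong_mat)
  hence "det (mat_delete ?B 0 0) = (\<Prod>i<M. e (Suc (Suc i)))"
    by (simp add: det_upper_triangular_mat)
  hence "cofactor ?B 0 0 = (\<Prod>i<M. e (Suc (Suc i)))" by (simp add: cofactor_def)
  also have "mat_delete ?B M 0 = trid (\<lambda>i. d (Suc i)) (\<lambda>i. e (Suc i)) M"
    unfolding B_mat trid_def by (subst mat_delete_mat) (auto intro!: eq_matI)
  hence "cofactor ?B M 0 = (-1) ^ M * contin (\<lambda>i. d (Suc i)) (\<lambda>i. e (Suc i)) M"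
    by (simp add: cofactor_def det_trid)
  finally have "det ?B = (\<Prod>i<M. e (Suc (Suc i))) * e (Suc 0)
      + (-1) ^ M * y * contin (\<lambda>i. d (Suc i)) (\<lambda>i. e (Suc i)) M"
    by (simp add: algebra_simps)
  hence detB: "det ?B = (\<Prod>i = 1..Suc M. e i)
      + (-1) ^ M * y * contin (\<lambda>i. d (Suc i)) (\<lambda>i. e (Suc i)) M"
    by (simp only: shift)
  \<comment> \<open>The minor of the entry just above the lower right corner.\<close>
  let ?C = "mat_delete ?A M (Suc M)"
  have C: "?C \<in> carrier_mat (Suc M) (Suc M)" using mat_delete_carrier[OF A] by simp
  have C_mat: "?C = mat (Suc M) (Suc M) (\<lambda>(a, b). ?f (if a < M then a else Suc a, b))"
    unfolding A_mat by (subst mat_delete_mat) (auto intro!: cong_mat)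
  have "det ?C = (\<Sum>j<Suc M. ?C $$ (M, j) * cofactor ?C M j)"
    using laplace_expansion_row[OF C, of M] by simp
  also have "\<dots> = ?C $$ (M, 0) * cofactor ?C M 0 + ?C $$ (M, M) * cofactor ?C M M"
    using assms by (intro sum_only_first_last) (auto simp: C_mat)
  also have "?C $$ (M, 0) = y" using assms by (simp add: C_mat)
  also have "?C $$ (M, M) = e (Suc M)" using assms by (simp add: C_mat)
  also have "mat_delete ?C M 0 = mat M M (\<lambda>(a, b). ?f (a, Suc b))"
    unfolding C_mat by (subst mat_delete_mat) (auto intro!: cong_mat)
  hence "det (mat_delete ?C M 0) = (\<Prod>i<M. e (Suc i))"
    by (simp add: det_lower_triangular_mat)
  hence "cofactor ?C M 0 = (-1) ^ M * (\<Prod>i<M. e (Suc i))" by (simp add: cofactor_def)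
  also have "mat_delete ?C M M = trid d e M"
    unfolding C_mat trid_def by (subst mat_delete_mat) (auto intro!: eq_matI)
  hence "cofactor ?C M M = contin d e M"
    by (simp add: cofactor_def det_trid)
  finally have "e (Suc M) * det ?C = (-1) ^ M * y * ((\<Prod>i<M. e (Suc i)) * e (Suc M)) + e (Suc M) ^ 2 * contin d e M"
    by (simp add: algebra_simps power2_eq_square)
  hence detC: "e (Suc M) * det ?C = (-1) ^ M * y * (\<Prod>i = 1..Suc M. e i) + e (Suc M) ^ 2 * contin d e M"
    by (simp only: shift')
  have "det ?A = (\<Sum>i<Suc (Suc M). ?A $$ (i, Suc M) * cofactor ?A i (Suc M))"
    using laplace_expansion_column[OF A, of "Suc M"] by simp
  also have "\<dots> = (\<Sum>i<Suc M. ?A $$ (i, Suc M) * cofactor ?A i (Suc M))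
       + ?A $$ (Suc M, Suc M) * cofactor ?A (Suc M) (Suc M)" by simp
  also have "(\<Sum>i<Suc M. ?A $$ (i, Suc M) * cofactor ?A i (Suc M)) =
      ?A $$ (0, Suc M) * cofactor ?A 0 (Suc M) + ?A $$ (M, Suc M) * cofactor ?A M (Suc M)"
    using assms by (intro sum_only_first_last) (auto simp: A_mat)
  also have "?A $$ (0, Suc M) = x" using assms by (simp add: A_mat)
  also have "?A $$ (M, Suc M) = e (Suc M)" by (simp add: A_mat)
  also have "?A $$ (Suc M, Suc M) = d (M + 2)" by (simp add: A_mat)
  also have "cofactor ?A 0 (Suc M) = (-1) ^ Suc M * det ?B" by (simp add: cofactor_def)
  also have "cofactor ?A M (Suc M) = - det ?C" by (simp add: cofactor_def)
  also have "cofactor ?A (Suc M) (Suc M) = contin d e (Suc M)"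
    by (simp add: cofactor_def last det_trid)
  finally have "det ?A = x * ((-1) ^ Suc M * det ?B) - e (Suc M) * det ?C + d (M + 2) * contin d e (Suc M)"
    by simp
  thus ?thesis unfolding detB detC
    by (simp add: algebra_simps del: prod.cl_ivl_Suc) 
qed

text \<open>
  The recurrence contains only squares of the off-diagonal entries, so their signs are invisible to
  the continuant. The normalization of matrices by sign changes rests on this.
\<close>
lemma contin_cong:
  assumes "\<And>i. i \<in> {1..k} \<Longrightarrow> d i = d' i" "\<And>i. i \<in> {1..<k} \<Longrightarrow> e i ^ 2 = e' i ^ 2"
  shows "contin d e k = contin d' e' k"
  using assms by (induction d e k rule: contin.induct) auto

text \<open>
  The left-hand side is a Casoratian: both \<open>k \<mapsto> contin d e (k + 1)\<close> and \<open>k \<mapsto> contin d' e' k\<close> solve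
  the same three-term recurrence, so each step multiplies it by the square of one off-diagonal entry.
\<close>
lemma contin_cross_identity:
  fixes d e :: "nat \<Rightarrow> 'a::comm_ring_1"
  defines "d' \<equiv> \<lambda>i. d (Suc i)" and "e' \<equiv> \<lambda>i. e (Suc i)"
  shows "contin d e (Suc k) * contin d' e' (Suc k) - contin d e (Suc (Suc k)) * contin d' e' k
    = (\<Prod>i = 1..Suc k. e i) ^ 2"
proof (induction k)
  case 0
  show ?case by (simp add: d'_def e'_def)
next
  case (Suc k)
  have "contin d e (Suc (Suc k)) * contin d' e' (Suc (Suc k))
      - contin d e (Suc (Suc (Suc k))) * contin d' e' (Suc k)
    = e (k + 2) ^ 2 * (contin d e (Suc k) * contin d' e' (Suc k) - contin d e (Suc (Suc k)) * contin d' e' k)"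
    unfolding contin.simps(3)[of d e "Suc k"] contin.simps(3)[of d' e' k]
    by (simp add: d'_def e'_def algebra_simps del: contin.simps)
  also have "\<dots> = (\<Prod>i = 1..Suc (Suc k). e i) ^ 2"
    unfolding Suc by (simp add: power_mult_distrib mult.commute)
  finally show ?case .
qed

section \<open>Characteristic polynomials of real Jacobi matrices\<close>

definition jacpoly :: "(nat \<Rightarrow> real) \<Rightarrow> (nat \<Rightarrow> real) \<Rightarrow> nat \<Rightarrow> real poly" where
  "jacpoly c b = contin (\<lambda>i. [:- c i, 1:]) (\<lambda>i. [:b i:])"

lemma jacpoly_0 [simp]: "jacpoly c b 0 = 1"
  and jacpoly_1 [simp]: "jacpoly c b (Suc 0) = [:- c 1, 1:]"
  and jacpoly_Suc_Suc: "jacpoly c b (Suc (Suc k)) =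
    [:- c (k + 2), 1:] * jacpoly c b (Suc k) - smult (b (k + 1) ^ 2) (jacpoly c b k)"
  by (simp_all add: jacpoly_def poly_const_pow)

lemma jacpoly_cong:
  assumes "\<And>i. i \<in> {1..k} \<Longrightarrow> c i = c' i" "\<And>i. i \<in> {1..<k} \<Longrightarrow> b i ^ 2 = b' i ^ 2"
  shows "jacpoly c b k = jacpoly c' b' k"
  unfolding jacpoly_def by (rule contin_cong) (use assms in \<open>auto simp: poly_const_pow\<close>)

lemma jacpoly_monic: "degree (jacpoly c b k) = k \<and> coeff (jacpoly c b k) k = 1"
proof (induction k rule: less_induct)
  case (less k)
  consider "k = 0" | "k = 1" | l where "k = Suc (Suc l)"
    by (metis One_nat_def not0_implies_Suc)
  thus ?case
  proof cases
    case 3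
    let ?P = "jacpoly c b (Suc l)" and ?Q = "jacpoly c b l"
    have P: "degree ?P = Suc l" "coeff ?P (Suc l) = 1" and Q: "degree ?Q = l"
      using less 3 by auto
    have [simp]: "coeff ?P k = 0" "coeff ?Q k = 0" using P Q 3 by (auto intro: coeff_eq_0)
    have "degree (jacpoly c b k) \<le> k"
      unfolding 3 jacpoly_Suc_Suc
      by (rule degree_diff_le; rule order_trans[OF degree_mult_le] order_trans[OF degree_smult_le])
        (use P Q in auto)
    moreover have "coeff (jacpoly c b k) k = 1"
      using P Q 3 by (simp add: 3 jacpoly_Suc_Suc coeff_eq_0)
    ultimately show ?thesis by (metis le_antisym le_degree zero_neq_one)
  qed (use less in auto)
qed

lemmas degree_jacpoly = jacpoly_monic[THEN conjunct1]
  and coeff_jacpoly = jacpoly_monic[THEN conjunct2]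

text \<open>
  The confluent Christoffel-Darboux identity in inductive form: by the recurrence each Wronskian is
  the square of a polynomial plus a positive multiple of the preceding Wronskian. At a root of
  \<open>jacpoly c b (Suc k)\<close> it says that \<open>jacpoly c b k\<close> has the sign of the derivative there.
\<close>
lemma jacpoly_wronskian_pos:
  assumes "\<And>i. i \<in> {1..k} \<Longrightarrow> b i \<noteq> 0"
  shows "poly (pderiv (jacpoly c b (Suc k))) x * poly (jacpoly c b k) x
    - poly (jacpoly c b (Suc k)) x * poly (pderiv (jacpoly c b k)) x > 0"
  using assms
proof (induction k)
  case 0
  show ?case by (simp add: pderiv_pCons)
next
  case (Suc k)
  let ?P = "poly (jacpoly c b (Suc k)) x" and ?Q = "poly (jacpoly c b k) x"
  let ?W = "poly (pderiv (jacpoly c b (Suc k))) x * ?Q - ?P * poly (pderiv (jacpoly c b k)) x"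
  have "poly (pderiv (jacpoly c b (Suc (Suc k)))) x * ?P
      - poly (jacpoly c b (Suc (Suc k))) x * poly (pderiv (jacpoly c b (Suc k))) x
    = ?P ^ 2 + b (k + 1) ^ 2 * ?W"
    unfolding jacpoly_Suc_Suc
    by (simp add: pderiv_mult pderiv_add pderiv_diff pderiv_smult pderiv_pCons algebra_simps power2_eq_square)
  moreover have "b (k + 1) ^ 2 * ?W > 0" using Suc by auto
  ultimately show ?case by (smt (verit) zero_le_power2)
qed

definition node_poly :: "(nat \<Rightarrow> 'a::comm_ring_1) \<Rightarrow> nat \<Rightarrow> 'a poly" where
  "node_poly mu N = (\<Prod>k = 1..N. [:- mu k, 1:])"

lemma poly_node_poly: "poly (node_poly mu N) x = (\<Prod>k = 1..N. x - mu k)"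
  by (simp add: node_poly_def poly_prod)

lemma node_poly_root: "k \<in> {1..N} \<Longrightarrow> poly (node_poly mu N) (mu k) = 0"
  unfolding poly_node_poly by (rule prod_zero) auto

lemma node_poly_monic:
  fixes mu :: "nat \<Rightarrow> 'a::idom"
  shows "degree (node_poly mu N) = N" "coeff (node_poly mu N) N = 1"
proof -
  show *: "degree (node_poly mu N) = N"
    unfolding node_poly_def by (subst degree_prod_eq_sum_degree) auto
  have "lead_coeff (node_poly mu N) = 1"
    unfolding node_poly_def by (simp add: lead_coeff_prod)
  thus "coeff (node_poly mu N) N = 1" by (simp add: *)
qed

lemma pderiv_node_poly_root:
  fixes mu :: "nat \<Rightarrow> real"
  assumes "k \<in> {1..N}"
  shows "poly (pderiv (node_poly mu N)) (mu k) = (\<Prod>i\<in>{1..N} - {k}. mu k - mu i)"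
proof -
  have "poly (pderiv (node_poly mu N)) (mu k) = (\<Sum>a = 1..N. \<Prod>i\<in>{1..N} - {a}. mu k - mu i)"
    unfolding node_poly_def pderiv_prod by (simp add: poly_sum poly_prod pderiv_pCons)
  also have "\<dots> = (\<Sum>a\<in>{k}. \<Prod>i\<in>{1..N} - {a}. mu k - mu i)"
    using assms by (intro sum.mono_neutral_right) (auto intro!: prod_zero)
  finally show ?thesis by simp
qed

text \<open>
  Only the factors with \<open>\<mu>\<^sub>i > x\<close> are negative. The sets \<open>A\<close> and \<open>B\<close> are left arbitrary, since the
  lemma serves both for a product over all nodes and for one that omits the node \<open>x\<close> itself.
\<close>
lemma sign_of_root_product:
  fixes mu :: "nat \<Rightarrow> real"
  assumes "finite A" "finite B" "A \<inter> B = {}" "\<And>i. i \<in> A \<Longrightarrow> mu i < x" "\<And>i. i \<in> B \<Longrightarrow> x < mu i"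
  shows "(-1) ^ card B * (\<Prod>i\<in>A \<union> B. x - mu i) > 0"
proof -
  have "(-1) ^ card B * (\<Prod>i\<in>A \<union> B. x - mu i) = (\<Prod>i\<in>A. x - mu i) * (\<Prod>i\<in>B. (-1) * (x - mu i))"
    unfolding prod.distrib prod_constant using assms by (simp add: prod.union_disjoint)
  also have "\<dots> > 0"
    by (rule mult_pos_pos; rule prod_pos) (use assms in auto)
  finally show ?thesis .
qed

lemma pderiv_node_poly_sign:
  fixes mu :: "nat \<Rightarrow> real"
  assumes "strict_mono_on {1..N} mu" "k \<in> {1..N}"
  shows "(-1) ^ (N - k) * poly (pderiv (node_poly mu N)) (mu k) > 0"
proof -
  have eq: "{1..N} - {k} = {1..<k} \<union> {Suc k..N}" using assms(2) by auto
  have "(-1) ^ card {Suc k..N} * (\<Prod>i\<in>{1..<k} \<union> {Suc k..N}. mu k - mu i) > 0"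
    using assms by (intro sign_of_root_product) (auto simp: strict_mono_on_def)
  thus ?thesis unfolding pderiv_node_poly_root[OF assms(2)] eq by simp
qed

section \<open>The inverse problem for Jacobi matrices\<close>

lemma degree_less_of_coeff_0:
  assumes "degree p \<le> N" "coeff p N = 0" "N \<ge> 1"
  shows "degree p < N"
  using assms by (metis degree_0 le_neq_implies_less leading_coeff_0_iff less_eq_Suc_le One_nat_def)

lemma poly_eq_on_nodes:
  fixes p q :: "'a::{comm_ring_1, ring_no_zero_divisors} poly"
  assumes "inj_on mu {1..N}" "degree p < N" "degree q < N"
    and "\<And>k. k \<in> {1..N} \<Longrightarrow> poly p (mu k) = poly q (mu k)"
  shows "p = q"
proof (rule poly_eqI_degree[where A = "mu ` {1..N}"])
  have "card (mu ` {1..N}) = N" using assms(1) by (simp add: card_image)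
  thus "degree p < card (mu ` {1..N})" "degree q < card (mu ` {1..N})" using assms by auto
qed (use assms in auto)

text \<open>
  One step of the Euclidean algorithm splits off the last row of the matrix. The alternating signs
  of \<open>T\<close> at the \<open>N\<close> nodes force \<open>N - 1\<close> roots of \<open>T\<close> that interlace them, so \<open>T\<close> is a positive
  multiple \<open>b\<^sub>N\<^sup>2\<close> of a monic \<open>R\<close> with these roots. The remainder of the division of the node
  polynomial by \<open>R\<close> alternates in sign at the roots of \<open>R\<close>, because the node polynomial does, and
  the induction hypothesis applies to \<open>R\<close> and the negated remainder.
\<close>
lemma jacobi_realization:
  fixes mu :: "nat \<Rightarrow> real"
  assumes "1 \<le> N" "strict_mono_on {1..N} mu" "degree T < N"
    and "\<And>k. k \<in> {1..N} \<Longrightarrow> (-1) ^ (N - k) * poly T (mu k) > 0"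
  shows "\<exists>c b. (\<forall>i\<in>{1..N}. b i > 0) \<and> jacpoly c b N = node_poly mu N
    \<and> smult (b N ^ 2) (jacpoly c b (N - 1)) = T"
  using assms
proof (induction N arbitrary: mu T rule: nat_induct_at_least)
  case base
  obtain t where T: "T = [:t:]" using base by (metis degree_eq_zeroE less_one)
  have "t > 0" using base(3)[of 1] by (simp add: T)
  hence "(\<forall>i\<in>{1..1}. sqrt t > 0) \<and> jacpoly mu (\<lambda>_. sqrt t) 1 = node_poly mu 1
    \<and> smult (sqrt t ^ 2) (jacpoly mu (\<lambda>_. sqrt t) (1 - 1)) = T"
    by (simp add: T node_poly_def)
  thus ?case by (intro exI[of _ mu] exI[of _ "\<lambda>_. sqrt t"])
next
  case (Suc N)
  note mono = strict_mono_onD[OF Suc.prems(1)]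
  have "\<exists>x. mu j < x \<and> x < mu (Suc j) \<and> poly T x = 0" if j: "j \<in> {1..N}" for j
  proof -
    have "(-1) ^ (N - j) * poly T (mu (Suc j)) > 0" using Suc.prems(3)[of "Suc j"] j by simp
    moreover have "(-1) ^ (N - j) * poly T (mu j) < 0"
      using Suc.prems(3)[of j] j by (simp add: Suc_diff_le)
    ultimately have "((-1) ^ (N - j) * poly T (mu (Suc j))) * ((-1) ^ (N - j) * poly T (mu j)) < 0"
      by (rule mult_pos_neg)
    hence "((-1) ^ (N - j) * (-1) ^ (N - j)) * (poly T (mu j) * poly T (mu (Suc j))) < 0"
      by (simp only: mult_ac)
    hence "poly T (mu j) * poly T (mu (Suc j)) < 0" by (simp flip: power_mult_distrib)
    thus ?thesis using poly_IVT[of "mu j" "mu (Suc j)" T] mono[of j "Suc j"] j by auto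
  qed
  then obtain nu where nu: "\<And>j. j \<in> {1..N} \<Longrightarrow> mu j < nu j \<and> nu j < mu (Suc j) \<and> poly T (nu j) = 0"
    by metis
  have mono_le: "mu i \<le> mu j" if "i \<le> j" "i \<in> {1..Suc N}" "j \<in> {1..Suc N}" for i j
    using that mono[of i j] by (cases "i = j") auto
  have nu_mono: "strict_mono_on {1..N} nu"
  proof (rule strict_mono_onI)
    fix i j assume ij: "i \<in> {1..N}" "j \<in> {1..N}" "i < j"
    hence "mu (Suc i) \<le> mu j" by (intro mono_le) auto
    thus "nu i < nu j" using nu[OF ij(1)] nu[OF ij(2)] by linarith
  qed
  let ?R = "node_poly nu N" and ?p = "node_poly mu (Suc N)"
  note R = node_poly_monic[of nu N] and p = node_poly_monic[of mu "Suc N"]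
  define t where "t = coeff T N"
  have T: "T = smult t ?R"
  proof -
    have "degree (T - smult t ?R) < N"
      using Suc.prems(2) Suc.hyps R
      by (intro degree_less_of_coeff_0 degree_diff_le order_trans[OF degree_smult_le]) (auto simp: t_def)
    hence "T - smult t ?R = 0"
      using Suc.hyps by (intro poly_eq_on_nodes[OF strict_mono_on_imp_inj_on[OF nu_mono]]) (auto simp: nu node_poly_root)
    thus ?thesis by simp
  qed
  have "t > 0"
  proof -
    have "poly T (mu (Suc N)) > 0" using Suc.prems(3)[of "Suc N"] by simp
    moreover have "poly ?R (mu (Suc N)) > 0"
    proof -
      have "nu j < mu (Suc N)" if "j \<in> {1..N}" for j
        using nu[OF that] mono_le[of "Suc j" "Suc N"] that by fastforce
      thus ?thesis unfolding poly_node_poly by (intro prod_pos) auto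
    qed
    ultimately show ?thesis unfolding T by (simp add: zero_less_mult_iff)
  qed
  \<comment> \<open>The last diagonal entry \<open>a\<close> is chosen to cancel the leading term: \<open>T2 = (X - a) R - p\<close> has degree below \<open>N\<close>.\<close>
  define D where "D = [:0, 1:] * ?R - ?p"
  define a where "a = coeff D N"
  define T2 where "T2 = D - smult a ?R"
  have D: "degree D \<le> N"
  proof -
    have "degree D \<le> Suc N"
      unfolding D_def using R p
      by (intro degree_diff_le order_trans[OF degree_mult_le]) auto
    moreover have "coeff D (Suc N) = 0" using R p by (simp add: D_def)
    ultimately have "degree D < Suc N" by (intro degree_less_of_coeff_0) auto
    thus ?thesis by simp
  qed
  have T2: "degree T2 < N" unfolding T2_def
    using D R Suc.hyps by (intro degree_less_of_coeff_0 degree_diff_le order_trans[OF degree_smult_le])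
      (auto simp: a_def)
  have "(-1) ^ (N - j) * poly T2 (nu j) > 0" if j: "j \<in> {1..N}" for j
  proof -
    have eq: "{1..Suc N} = {1..j} \<union> {Suc j..Suc N}" using j by auto
    have "(-1) ^ card {Suc j..Suc N} * (\<Prod>i\<in>{1..j} \<union> {Suc j..Suc N}. nu j - mu i) > 0"
    proof (intro sign_of_root_product)
      show "mu i < nu j" if "i \<in> {1..j}" for i using mono_le[of i j] nu[OF j] that j by fastforce
      show "nu j < mu i" if "i \<in> {Suc j..Suc N}" for i using mono_le[of "Suc j" i] nu[OF j] that j by fastforce
    qed auto
    hence "(-1) ^ (Suc N - j) * poly ?p (nu j) > 0"
      unfolding poly_node_poly eq by simp
    moreover have "poly T2 (nu j) = - poly ?p (nu j)"
      using j by (simp add: T2_def D_def node_poly_root)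
    ultimately show ?thesis using j by (simp add: Suc_diff_le)
  qed
  from Suc.IH[OF nu_mono T2 this] obtain c b where
    cb: "\<forall>i\<in>{1..N}. b i > 0" "jacpoly c b N = ?R" "smult (b N ^ 2) (jacpoly c b (N - 1)) = T2"
    by blast
  \<comment> \<open>Recomputing \<open>jacpoly\<close> at level \<open>Suc N\<close> reverses the division, \<open>p = (X - a) R - T2\<close>.\<close>
  let ?c = "c(Suc N := a)" and ?b = "b(Suc N := sqrt t)"
  have 1: "jacpoly ?c ?b N = ?R" unfolding cb(2)[symmetric] by (rule jacpoly_cong) auto
  have 2: "jacpoly ?c ?b (N - 1) = jacpoly c b (N - 1)" by (rule jacpoly_cong) auto
  obtain M where M: "N = Suc M" using Suc.hyps by (cases N) auto
  have "jacpoly ?c ?b (Suc N) = [:- a, 1:] * ?R - T2"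
    using 1 2 cb(3) by (simp add: M jacpoly_Suc_Suc)
  also have "\<dots> = ?p" by (simp add: T2_def D_def)
  finally have "jacpoly ?c ?b (Suc N) = ?p" .
  moreover have "smult (?b (Suc N) ^ 2) (jacpoly ?c ?b (Suc N - 1)) = T"
    using 1 \<open>t > 0\<close> by (simp add: T)
  moreover have "\<forall>i\<in>{1..Suc N}. ?b i > 0" using cb(1) \<open>t > 0\<close> by auto
  ultimately show ?case by blast
qed

text \<open>
  The Euclidean algorithm leaves no freedom: the leading coefficient of the second polynomial is
  \<open>b\<^sub>N\<^sup>2\<close>, and comparing the coefficients of \<open>X\<^sup>N\<^sup>-\<^sup>1\<close> in the recurrence gives \<open>c\<^sub>N\<close>.
\<close>
lemma jacobi_unique:
  assumes "1 \<le> N" "\<And>i. i \<in> {1..N} \<Longrightarrow> b i > 0" "\<And>i. i \<in> {1..N} \<Longrightarrow> b' i > 0"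
    and "jacpoly c b N = jacpoly c' b' N"
    and "smult (b N ^ 2) (jacpoly c b (N - 1)) = smult (b' N ^ 2) (jacpoly c' b' (N - 1))"
  shows "\<forall>i\<in>{1..N}. c i = c' i \<and> b i = b' i"
  using assms
proof (induction N rule: nat_induct_at_least)
  case base
  have "b 1 = b' 1" using base by (auto simp: power2_eq_iff)
  thus ?case using base by simp
next
  case (Suc N)
  let ?R = "jacpoly c b N"
  obtain M where M: "N = Suc M" using Suc.hyps by (cases N) auto
  have "b (Suc N) ^ 2 = b' (Suc N) ^ 2"
    using arg_cong[OF Suc.prems(4), of "\<lambda>p. coeff p N"] by (simp add: coeff_jacpoly)
  moreover have pos: "b (Suc N) > 0" "b' (Suc N) > 0" using Suc.prems by auto
  ultimately have bN: "b (Suc N) = b' (Suc N)" by (simp add: power2_eq_iff)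
  hence R: "?R = jacpoly c' b' N" using Suc.prems(4) pos by (simp add: smult_eq_iff)
  have *: "[:- c (Suc N), 1:] * ?R - smult (b N ^ 2) (jacpoly c b (N - 1))
      = [:- c' (Suc N), 1:] * ?R - smult (b' N ^ 2) (jacpoly c' b' (N - 1))"
    using Suc.prems(3) R by (simp add: M jacpoly_Suc_Suc)
  have "coeff (jacpoly c b (N - 1)) N = 0" "coeff (jacpoly c' b' (N - 1)) N = 0"
    by (auto intro!: coeff_eq_0 simp: degree_jacpoly M)
  with arg_cong[OF *, of "\<lambda>p. coeff p N"] have cN: "c (Suc N) = c' (Suc N)"
    by (simp add: coeff_jacpoly)
  have "\<forall>i\<in>{1..N}. c i = c' i \<and> b i = b' i"
    using Suc.prems R * by (intro Suc.IH) (auto simp: cN)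
  thus ?case using bN cN by (auto simp: le_Suc_eq)
qed

section \<open>Characteristic polynomials in the class\<close>

interpretation of_real_poly_hom: map_poly_inj_idom_hom "of_real :: real \<Rightarrow> complex" ..

abbreviation cpoly :: "real poly \<Rightarrow> complex poly" where
  "cpoly \<equiv> map_poly of_real"

lemma contin_of_real:
  "contin (\<lambda>i. [:- complex_of_real (c i), 1:]) (\<lambda>i. [:- complex_of_real (b i):]) k = cpoly (jacpoly c b k)"
proof (induction k rule: less_induct)
  case (less k)
  consider "k = 0" | "k = 1" | l where "k = Suc (Suc l)"
    by (metis One_nat_def not0_implies_Suc)
  thus ?case
  proof cases
    case 3
    thus ?thesis using less
      by (simp add: jacpoly_Suc_Suc of_real_poly_hom.hom_minus of_real_poly_hom.hom_mult poly_const_pow of_real_hom.map_poly_hom_smult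
        of_real_poly_hom.hom_add of_real_hom.map_poly_pCons_hom)
  qed auto
qed

lemma poly_cpoly [simp]: "poly (cpoly p) (of_real x) = of_real (poly p x)"
  by (rule of_real_hom.poly_map_poly)

text \<open>
  The real polynomial by which the characteristic polynomial of \<open>Jhat_mat\<close> falls short of
  \<open>X - a\<^sub>n\<close> times that of its leading block: the last off-diagonal entry contributes the block
  without its last row and column, the corner entry the block without its first row and column, and
  the closed cycle through all off-diagonal entries, in its two orientations, contributes \<open>2 Re \<beta>\<close>.
\<close>
definition corner_poly :: "(nat \<Rightarrow> real) \<Rightarrow> (nat \<Rightarrow> real) \<Rightarrow> complex \<Rightarrow> nat \<Rightarrow> real poly" where
  "corner_poly c b bn M = smult (b (Suc M) ^ 2) (jacpoly c b M)
     + smult (cmod bn ^ 2) (jacpoly (\<lambda>i. c (Suc i)) (\<lambda>i. b (Suc i)) M)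
     + [:2 * Re (of_real (\<Prod>i = 1..Suc M. b i) * bn):]"

lemma degree_corner_poly: "degree (corner_poly c b bn M) \<le> M"
  unfolding corner_poly_def
  by (intro degree_add_le order_trans[OF degree_smult_le]) (auto simp: degree_jacpoly)

lemma char_poly_Jhat_mat:
  assumes "1 \<le> M"
  shows "char_poly (Jhat_mat (Suc (Suc M)) c b an bn) =
    [:- an, 1:] * cpoly (jacpoly c b (Suc M)) - cpoly (corner_poly c b bn M)"
proof -
  let ?n = "Suc (Suc M)"
  let ?d = "\<lambda>i. if i = ?n then [:- an, 1:] else [:- complex_of_real (c i), 1:]"
  let ?e = "\<lambda>i. [:- complex_of_real (b i):]"
  let ?Q = "jacpoly (\<lambda>i. c (Suc i)) (\<lambda>i. b (Suc i)) M"
  \<comment> \<open>Only the last diagonal entry may be nonreal, hence the case distinction in \<open>?d\<close>.\<close>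
  have "char_poly_matrix (Jhat_mat ?n c b an bn) = ptrid ?d ?e [:- cnj bn:] [:- bn:] ?n"
    unfolding char_poly_matrix_def Jhat_mat_def ptrid_def using assms by (intro eq_matI) auto
  hence "char_poly (Jhat_mat ?n c b an bn) =
     contin ?d ?e ?n - [:- cnj bn:] * [:- bn:] * contin (\<lambda>i. ?d (Suc i)) (\<lambda>i. ?e (Suc i)) M
      + (-1) ^ Suc M * ([:- cnj bn:] + [:- bn:]) * (\<Prod>i = 1..Suc M. ?e i)"
    unfolding char_poly_def by (simp only: det_ptrid[OF assms])
  also have "contin (\<lambda>i. ?d (Suc i)) (\<lambda>i. ?e (Suc i)) M = cpoly ?Q"
    unfolding contin_of_real[symmetric] by (rule contin_cong) auto
  also have "contin ?d ?e ?n = [:- an, 1:] * contin ?d ?e (Suc M) - ?e (Suc M) ^ 2 * contin ?d ?e M"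
    by simp
  also have "contin ?d ?e (Suc M) = cpoly (jacpoly c b (Suc M))"
    unfolding contin_of_real[symmetric] by (rule contin_cong) auto
  also have "contin ?d ?e M = cpoly (jacpoly c b M)"
    unfolding contin_of_real[symmetric] by (rule contin_cong) auto
  also have "?e (Suc M) ^ 2 * cpoly (jacpoly c b M) = cpoly (smult (b (Suc M) ^ 2) (jacpoly c b M))"
    by (simp add: poly_const_pow of_real_hom.map_poly_hom_smult)
  also have "[:- cnj bn:] * [:- bn:] * cpoly ?Q = cpoly (smult (cmod bn ^ 2) ?Q)"
    unfolding of_real_hom.map_poly_hom_smult complex_norm_square by (simp add: mult.commute)
  also have "(-1) ^ Suc M * ([:- cnj bn:] + [:- bn:]) * (\<Prod>i = 1..Suc M. ?e i)
      = - cpoly [:2 * Re (of_real (\<Prod>i = 1..Suc M. b i) * bn):]"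
  proof -
    let ?B = "\<Prod>i = 1..Suc M. b i"
    have "(\<Prod>i = 1..k. ?e i) = (-1) ^ k * [:of_real (\<Prod>i = 1..k. b i):]" for k
      by (induction k) (auto simp: ac_simps)
    hence "(-1) ^ Suc M * ([:- cnj bn:] + [:- bn:]) * (\<Prod>i = 1..Suc M. ?e i)
       = ((-1) ^ Suc M * (-1) ^ Suc M) * (([:- cnj bn:] + [:- bn:]) * [:of_real ?B:])"
      by (simp only: mult_ac)
    also have "\<dots> = ([:- cnj bn:] + [:- bn:]) * [:of_real ?B:]"
      by (simp flip: power_mult_distrib)
    also have "([:- cnj bn:] + [:- bn:]) * [:of_real x:] = - cpoly [:2 * Re (of_real x * bn):]" for x
      by (simp add: complex_eq_iff of_real_hom.map_poly_pCons_hom algebra_simps)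
    finally show ?thesis .
  qed
  finally show ?thesis
    by (simp add: corner_poly_def of_real_poly_hom.hom_add algebra_simps del: prod.cl_ivl_Suc)
qed

lemma pick_lessThan: "i < m \<Longrightarrow> pick {..<m} i = i"
  using pick_reduce_set[of i m UNIV] by (simp add: pick_UNIV lessThan_def)

lemma char_poly_Jhat_submatrix:
  "char_poly (submatrix (Jhat_mat (Suc N) c b an bn) {..<N} {..<N}) = cpoly (jacpoly c b N)"
proof -
  define J where "J = Jhat_mat (Suc N) c b an bn"
  define S where "S = submatrix J {..<N} {..<N}"
  have N: "{i. i < dim_row J \<and> i \<in> {..<N}} = {..<N}" "{i. i < dim_col J \<and> i \<in> {..<N}} = {..<N}"
    by (auto simp: J_def Jhat_mat_def)
  have dim: "dim_row S = N" "dim_col S = N"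
    unfolding S_def dim_submatrix N by simp_all
  have "S $$ (i, j) = J $$ (i, j)" if "i < N" "j < N" for i j
    unfolding S_def using that by (subst submatrix_index) (simp_all only: N card_lessThan pick_lessThan)
  hence entry: "S $$ (i, j) = of_real (if i = j then c (i + 1) else if j = i + 1 then b (i + 1)
      else if i = j + 1 then b (j + 1) else 0)" if "i < N" "j < N" for i j
    using that by (simp add: J_def Jhat_mat_def)
  have "char_poly_matrix S =
    trid (\<lambda>i. [:- complex_of_real (c i), 1:]) (\<lambda>i. [:- complex_of_real (b i):]) N"
    unfolding char_poly_matrix_def trid_def
    by (rule eq_matI) (auto simp: dim entry)
  thus ?thesis by (simp add: char_poly_def det_trid contin_of_real S_def J_def)
qed

text \<open>
  A monic complex polynomial is determined by the multiset of its roots, so conditions on spectra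
  become equations between polynomials.
\<close>
lemma mspectrum_eq_iff:
  assumes "A \<in> carrier_mat n n"
  shows "mspectrum A = image_mset f (mset_set {1..n}) \<longleftrightarrow> char_poly A = node_poly f n"
proof
  have "proots (node_poly f n) = (\<Sum>x = 1..n. {#f x#})"
    unfolding node_poly_def by (subst proots_prod) auto
  hence *: "proots (node_poly f n) = image_mset f (mset_set {1..n})"
    by (simp add: sum_unfold_sum_mset)
  show "mspectrum A = image_mset f (mset_set {1..n})" if "char_poly A = node_poly f n"
    using that * by (simp add: mspectrum_def)
  assume "mspectrum A = image_mset f (mset_set {1..n})"
  hence "(\<Prod>x\<in>#proots (node_poly f n). [:-x, 1:]) = char_poly A"
    using complex_poly_decompose_multiset[of "char_poly A"] degree_monic_char_poly[OF assms] *
    by (simp add: mspectrum_def)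
  moreover have "(\<Prod>x\<in>#proots (node_poly f n). [:-x, 1:]) = node_poly f n"
    using complex_poly_decompose_multiset[of "node_poly f n"] node_poly_monic[of f n] by simp
  ultimately show "char_poly A = node_poly f n" by simp
qed

lemma node_poly_Suc: "node_poly mu (Suc N) = [:- mu (Suc N), 1:] * node_poly mu N"
  by (simp add: node_poly_def)

lemma cpoly_node_poly: "cpoly (node_poly mu N) = node_poly (\<lambda>k. of_real (mu k)) N"
  by (induction N) (simp add: node_poly_def, simp add: node_poly_Suc of_real_poly_hom.hom_mult of_real_poly_hom.hom_minus
      of_real_hom.map_poly_pCons_hom of_real_hom.map_poly_hom_smult)

lemma coeff_node_poly_subleading:
  fixes mu :: "nat \<Rightarrow> 'a::idom"
  shows "coeff (node_poly mu (Suc N)) N = - (\<Sum>k = 1..Suc N. mu k)"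
proof (induction N)
  case (Suc N)
  have "coeff (node_poly mu (Suc (Suc N))) (Suc N) =
      coeff (node_poly mu (Suc N)) N - mu (Suc (Suc N)) * coeff (node_poly mu (Suc N)) (Suc N)"
    by (subst node_poly_Suc) simp
  thus ?case using Suc node_poly_monic[of mu "Suc N"] by simp
qed (simp add: node_poly_def)

lemma poly_node_poly_chi: "poly (node_poly lam n) z = chi n lam z"
  by (simp add: poly_node_poly chi_def)

text \<open>
  Both sides are monic of degree \<open>M + 2\<close>. Equality of the next coefficient is the trace condition on
  \<open>a\<close>, and once it holds the difference has degree at most \<open>M\<close>, so it vanishes as soon as it
  vanishes at the \<open>M + 1\<close> nodes, where the first term of the left-hand side drops out.
\<close>
lemma bordered_poly_eq_iff:
  fixes mu :: "nat \<Rightarrow> real"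
  assumes "inj_on mu {1..Suc M}" "degree S \<le> M"
  shows "[:- a, 1:] * cpoly (node_poly mu (Suc M)) - cpoly S = node_poly lam (Suc (Suc M)) \<longleftrightarrow>
     a = (\<Sum>j = 1..Suc (Suc M). lam j) - of_real (\<Sum>k = 1..Suc M. mu k) \<and>
     (\<forall>k \<in> {1..Suc M}. chi (Suc (Suc M)) lam (of_real (mu k)) = of_real (- poly S (mu k)))"
    (is "?L = ?X \<longleftrightarrow> ?a \<and> ?v")
proof -
  let ?P = "node_poly (\<lambda>k. complex_of_real (mu k)) (Suc M)"
  have inj: "inj_on (\<lambda>k. complex_of_real (mu k)) {1..Suc M}"
    using assms(1) by (auto simp: inj_on_def)
  note P = node_poly_monic[of "\<lambda>k. complex_of_real (mu k)" "Suc M"]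
    coeff_node_poly_subleading[of "\<lambda>k. complex_of_real (mu k)" M]
  note X = node_poly_monic[of lam "Suc (Suc M)"] coeff_node_poly_subleading[of lam "Suc M"]
  have S: "degree (cpoly S) \<le> M" using assms(2) by (simp add: degree_map_poly)
  hence S0: "coeff (cpoly S) (Suc M) = 0" "coeff (cpoly S) (Suc (Suc M)) = 0"
    by (auto intro!: coeff_eq_0)
  have coeff_L: "coeff ?L (Suc M) = - a - of_real (\<Sum>k = 1..Suc M. mu k)"
    unfolding cpoly_node_poly using P S0 by simp
  have top_L: "coeff ?L (Suc (Suc M)) = 1"
    unfolding cpoly_node_poly using P S0 by (simp add: coeff_eq_0)
  have poly_L: "poly ?L (of_real (mu k)) = of_real (- poly S (mu k))" if "k \<in> {1..Suc M}" for k
    using that by (simp add: node_poly_root)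
  show ?thesis
  proof
    assume eq: "?L = ?X"
    have ?a using coeff_L X(3) unfolding eq by (simp add: algebra_simps)
    moreover have ?v using poly_L unfolding eq poly_node_poly_chi by blast
    ultimately show "?a \<and> ?v" by blast
  next
    assume r: "?a \<and> ?v"
    have "degree ?L \<le> Suc (Suc M)"
      unfolding cpoly_node_poly using P S
      by (intro degree_diff_le order_trans[OF degree_mult_le]) auto
    hence "degree (?L - ?X) < Suc (Suc M)"
      using X top_L by (intro degree_less_of_coeff_0 degree_diff_le[of ?L _ ?X]) simp_all
    moreover have "coeff (?L - ?X) (Suc M) = 0"
      using coeff_L X(3) r by (simp del: sum.cl_ivl_Suc)
    ultimately have "degree (?L - ?X) < Suc M"
      by (intro degree_less_of_coeff_0) auto
    hence "?L - ?X = 0"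
    proof (rule poly_eq_on_nodes[OF inj])
      fix k assume k: "k \<in> {1..Suc M}"
      show "poly (?L - ?X) (of_real (mu k)) = poly 0 (of_real (mu k))"
        using poly_L[OF k] r k by (simp add: poly_node_poly_chi)
    qed simp
    thus "?L = ?X" by simp
  qed
qed

lemma Jhat_mat_spectra_iff:
  fixes mu c b :: "nat \<Rightarrow> real" and an bn :: complex
  assumes "1 \<le> M" "inj_on mu {1..Suc M}"
  defines "J \<equiv> Jhat_mat (Suc (Suc M)) c b an bn"
  shows "mspectrum J = image_mset lam (mset_set {1..Suc (Suc M)}) \<and>
     mspectrum (submatrix J {..<Suc M} {..<Suc M}) = image_mset (\<lambda>k. of_real (mu k)) (mset_set {1..Suc M})
   \<longleftrightarrow> jacpoly c b (Suc M) = node_poly mu (Suc M) \<and>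
     an = (\<Sum>j = 1..Suc (Suc M). lam j) - of_real (\<Sum>k = 1..Suc M. mu k) \<and>
     (\<forall>k \<in> {1..Suc M}. chi (Suc (Suc M)) lam (of_real (mu k)) = of_real (- poly (corner_poly c b bn M) (mu k)))"
proof -
  have "J \<in> carrier_mat (Suc (Suc M)) (Suc (Suc M))" by (simp add: J_def Jhat_mat_def)
  note 1 = mspectrum_eq_iff[OF this, of lam, unfolded J_def char_poly_Jhat_mat[OF assms(1)], folded J_def]
  have "submatrix J {..<Suc M} {..<Suc M} \<in> carrier_mat (Suc M) (Suc M)"
  proof -
    have "{i. i < dim_row J \<and> i \<in> {..<Suc M}} = {..<Suc M}"
      "{i. i < dim_col J \<and> i \<in> {..<Suc M}} = {..<Suc M}"
      by (auto simp: J_def Jhat_mat_def)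
    thus ?thesis by (intro carrier_matI) (simp_all only: dim_submatrix card_lessThan)
  qed
  note 2 = mspectrum_eq_iff[OF this, of "\<lambda>k. of_real (mu k)", unfolded J_def char_poly_Jhat_submatrix, folded J_def]
  have 3: "cpoly (jacpoly c b (Suc M)) = node_poly (\<lambda>k. of_real (mu k)) (Suc M)
      \<longleftrightarrow> jacpoly c b (Suc M) = node_poly mu (Suc M)"
    unfolding cpoly_node_poly[symmetric] by simp
  show ?thesis
    unfolding 1 2 3
    using bordered_poly_eq_iff[OF assms(2) degree_corner_poly, of an c b bn lam] by auto
qed

section \<open>Spectral data and quadratic equations\<close>

lemma spectral_matrices_Jhat_iff:
  fixes mu c b :: "nat \<Rightarrow> real" and an bn :: complex
  assumes "1 \<le> M" "inj_on mu {1..Suc M}" "bn \<noteq> 0"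
  shows "Jhat_mat (Suc (Suc M)) c b an bn \<in> spectral_matrices (Suc (Suc M)) lam mu \<beta> \<longleftrightarrow>
     of_real (\<Prod>i = 1..Suc M. b i) * bn = \<beta> \<and>
     jacpoly c b (Suc M) = node_poly mu (Suc M) \<and>
     an = (\<Sum>j = 1..Suc (Suc M). lam j) - of_real (\<Sum>k = 1..Suc M. mu k) \<and>
     (\<forall>k \<in> {1..Suc M}. chi (Suc (Suc M)) lam (of_real (mu k)) = of_real (- poly (corner_poly c b bn M) (mu k)))"
proof -
  let ?J = "Jhat_mat (Suc (Suc M)) c b an bn"
  have "?J \<in> Jhat_class (Suc (Suc M))" using assms(3) by (auto simp: Jhat_class_def)
  moreover have "offdiag_prod (Suc (Suc M)) ?J = of_real (\<Prod>i = 1..Suc M. b i) * bn"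
  proof -
    have "(\<Prod>k = 1..Suc M. ?J $$ (k, k - 1)) = (\<Prod>k = 1..Suc M. of_real (b k))"
      by (rule prod.cong) (auto simp: Jhat_mat_def)
    moreover have "?J $$ (Suc M, 0) = bn" using assms(1) by (auto simp: Jhat_mat_def)
    ultimately show ?thesis by (simp add: offdiag_prod_def del: prod.cl_ivl_Suc)
  qed
  ultimately show ?thesis
    using Jhat_mat_spectra_iff[OF assms(1,2), of c b an bn lam]
    by (simp add: spectral_matrices_def del: prod.cl_ivl_Suc sum.cl_ivl_Suc)
qed

text \<open>
  The Casoratian identity at a root of \<open>jacpoly c b (Suc M)\<close>, where its second product vanishes.
\<close>
lemma jacpoly_minor_product_at_root:
  assumes "1 \<le> M" "poly (jacpoly c b (Suc M)) x = 0"
  shows "poly (jacpoly c b M) x * poly (jacpoly (\<lambda>i. c (Suc i)) (\<lambda>i. b (Suc i)) M) x = (\<Prod>i = 1..M. b i) ^ 2"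
proof -
  obtain k where M: "M = Suc k" using assms(1) by (cases M) auto
  have prod: "(\<Prod>i = 1..M. [:b i:]) = [:\<Prod>i = 1..M. b i:]"
    by (induction M) (auto simp: mult.commute)
  have "jacpoly c b (Suc k) * jacpoly (\<lambda>i. c (Suc i)) (\<lambda>i. b (Suc i)) (Suc k)
      - jacpoly c b (Suc (Suc k)) * jacpoly (\<lambda>i. c (Suc i)) (\<lambda>i. b (Suc i)) k = [:(\<Prod>i = 1..M. b i) ^ 2:]"
    unfolding jacpoly_def poly_const_pow[symmetric] prod[symmetric] unfolding M
    by (rule contin_cross_identity)
  from arg_cong[OF this, of "\<lambda>p. poly p x"] show ?thesis
    using assms(2) by (simp add: M)
qed

text \<open>
  At an eigenvalue of the leading block the two matrix terms \<open>y\<close> and \<open>z\<close> of the corner polynomial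
  have a product that depends on \<open>\<beta>\<close> alone. So \<open>y\<close> and \<open>z\<close> are the two roots of a quadratic equation
  whose coefficients are spectral data, and the only freedom is which root is called \<open>y\<close>.
\<close>
lemma corner_poly_at_root:
  assumes "1 \<le> M" "poly (jacpoly c b (Suc M)) x = 0" "of_real (\<Prod>i = 1..Suc M. b i) * bn = \<beta>"
  defines "y \<equiv> poly (smult (b (Suc M) ^ 2) (jacpoly c b M)) x"
  obtains z where "poly (corner_poly c b bn M) x = y + z + 2 * Re \<beta>" "y * z = cmod \<beta> ^ 2"
proof
  let ?z = "cmod bn ^ 2 * poly (jacpoly (\<lambda>i. c (Suc i)) (\<lambda>i. b (Suc i)) M) x"
  show "poly (corner_poly c b bn M) x = y + ?z + 2 * Re \<beta>"
    unfolding corner_poly_def assms(3) y_def by simp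
  have "y * ?z = b (Suc M) ^ 2 * cmod bn ^ 2 * (\<Prod>i = 1..M. b i) ^ 2"
    unfolding y_def jacpoly_minor_product_at_root[OF assms(1,2), symmetric] by simp
  also have "\<dots> = cmod \<beta> ^ 2"
    unfolding assms(3)[symmetric] norm_mult norm_of_real power_mult_distrib
    by (simp add: power_mult_distrib mult_ac)
  finally show "y * ?z = cmod \<beta> ^ 2" .
qed

lemma jacpoly_minor_sign:
  assumes "strict_mono_on {1..Suc M} mu" "jacpoly c b (Suc M) = node_poly mu (Suc M)"
    and "\<And>i. i \<in> {1..Suc M} \<Longrightarrow> b i \<noteq> 0" "k \<in> {1..Suc M}"
  shows "(-1) ^ (Suc M - k) * poly (smult (b (Suc M) ^ 2) (jacpoly c b M)) (mu k) > 0"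
proof -
  let ?p' = "poly (pderiv (node_poly mu (Suc M))) (mu k)" and ?r = "poly (jacpoly c b M) (mu k)"
  have "?p' * ?r > 0"
    using jacpoly_wronskian_pos[of M b c "mu k"] assms(2,3) node_poly_root[OF assms(4), of mu] by simp
  moreover have "(-1) ^ (Suc M - k) * ?p' > 0" by (rule pderiv_node_poly_sign[OF assms(1,4)])
  ultimately have "((-1) ^ (Suc M - k) * ?p') * (?p' * ?r) > 0" by simp
  hence "?p' ^ 2 * ((-1) ^ (Suc M - k) * ?r) > 0" by (simp add: power2_eq_square mult_ac)
  hence "(-1) ^ (Suc M - k) * ?r > 0" by (simp add: zero_less_mult_iff)
  moreover have "b (Suc M) ^ 2 > 0" using assms(3)[of "Suc M"] by simp
  ultimately have "b (Suc M) ^ 2 * ((-1) ^ (Suc M - k) * ?r) > 0" by (rule mult_pos_pos[rotated])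
  thus ?thesis by (simp add: mult_ac)
qed

text \<open>
  The arithmetic-geometric mean inequality for two numbers of the same sign, stated with a sign
  factor \<open>\<sigma>\<close> because the common sign alternates with the eigenvalue.
\<close>
lemma sum_ge_of_product_eq_square:
  fixes y z :: real
  assumes "y * z = B ^ 2" "B > 0"
  shows "\<bar>y + z\<bar> \<ge> 2 * B" "\<sigma> * y > 0 \<Longrightarrow> \<sigma> * (y + z) > 0"
proof -
  have "(y + z) ^ 2 = (y - z) ^ 2 + 4 * B ^ 2"
    using assms(1) by (simp add: power2_eq_square algebra_simps)
  hence "(2 * B) ^ 2 \<le> (y + z) ^ 2" by simp
  hence "\<bar>2 * B\<bar> \<le> \<bar>y + z\<bar>" by (rule abs_le_square_iff[THEN iffD2])
  thus "\<bar>y + z\<bar> \<ge> 2 * B" by linarith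
  assume "\<sigma> * y > 0"
  moreover have "(\<sigma> * y) * (\<sigma> * z) > 0"
  proof -
    have "\<sigma> \<noteq> 0" using \<open>\<sigma> * y > 0\<close> by auto
    hence "\<sigma> ^ 2 * B ^ 2 > 0" using assms(2) by simp
    thus ?thesis unfolding assms(1)[symmetric] by (simp add: power2_eq_square mult_ac)
  qed
  ultimately have "\<sigma> * z > 0" by (rule zero_less_mult_pos[rotated])
  thus "\<sigma> * (y + z) > 0" using \<open>\<sigma> * y > 0\<close> by (simp add: distrib_left)
qed

lemma card_quadratic_roots:
  fixes s B :: real
  assumes "\<bar>s\<bar> \<ge> 2 * B" "B > 0"
  shows "finite {y. y ^ 2 + s * y + B ^ 2 = 0}"
    "card {y. y ^ 2 + s * y + B ^ 2 = 0} = (if \<bar>s\<bar> = 2 * B then 1 else 2)"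
proof -
  define d where "d = sqrt (s ^ 2 - 4 * B ^ 2)"
  have "(2 * B) ^ 2 \<le> s ^ 2" by (rule abs_le_square_iff[THEN iffD1]) (use assms in linarith)
  hence d: "d ^ 2 = s ^ 2 - 4 * B ^ 2" by (simp add: d_def)
  have "y ^ 2 + s * y + B ^ 2 = 0 \<longleftrightarrow> y = (- s + d) / 2 \<or> y = (- s - d) / 2" for y
  proof -
    have "4 * (y ^ 2 + s * y + B ^ 2) = (2 * y + s) ^ 2 - d ^ 2"
      unfolding d by (simp add: power2_eq_square algebra_simps)
    hence "4 * (y ^ 2 + s * y + B ^ 2) = 0 \<longleftrightarrow> (2 * y + s) ^ 2 = d ^ 2" by (simp only: right_minus_eq)
    hence "y ^ 2 + s * y + B ^ 2 = 0 \<longleftrightarrow> (2 * y + s) ^ 2 = d ^ 2"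
      by (simp only: mult_eq_0_iff zero_neq_numeral[symmetric] simp_thms)
    also have "\<dots> \<longleftrightarrow> 2 * y + s = d \<or> 2 * y + s = - d" by (rule power2_eq_iff)
    also have "2 * y + s = d \<longleftrightarrow> y = (- s + d) / 2" by auto
    also have "2 * y + s = - d \<longleftrightarrow> y = (- s - d) / 2" by auto
    finally show ?thesis .
  qed
  hence set: "{y. y ^ 2 + s * y + B ^ 2 = 0} = {(- s + d) / 2, (- s - d) / 2}" by blast
  thus "finite {y. y ^ 2 + s * y + B ^ 2 = 0}" by simp
  have "d = 0 \<longleftrightarrow> d ^ 2 = 0" by simp
  also have "\<dots> \<longleftrightarrow> s ^ 2 = (2 * B) ^ 2" unfolding d by simp
  also have "\<dots> \<longleftrightarrow> \<bar>s\<bar> = 2 * B" unfolding power2_eq_iff using assms(2) by (auto simp: abs_if)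
  finally show "card {y. y ^ 2 + s * y + B ^ 2 = 0} = (if \<bar>s\<bar> = 2 * B then 1 else 2)"
    unfolding set by (auto simp: card_insert_if)
qed

lemma newton_interpolation:
  fixes y :: "nat \<Rightarrow> 'a::field"
  assumes "inj_on mu {1..Suc M}"
  shows "\<exists>T. degree T < Suc M \<and> (\<forall>k \<in> {1..Suc M}. poly T (mu k) = y k)"
  using assms
proof (induction M)
  case 0
  show ?case by (rule exI[of _ "[:y 1:]"]) auto
next
  case (Suc M)
  have "inj_on mu {1..Suc M}" using Suc.prems by (rule inj_on_subset) auto
  then obtain T where T: "degree T < Suc M" "\<forall>k \<in> {1..Suc M}. poly T (mu k) = y k"
    using Suc.IH by blast
  let ?w = "node_poly mu (Suc M)" and ?x = "mu (Suc (Suc M))"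
  let ?T = "T + smult ((y (Suc (Suc M)) - poly T ?x) / poly ?w ?x) ?w"
  have "poly ?w ?x \<noteq> 0"
    unfolding poly_node_poly using inj_onD[OF Suc.prems, of "Suc (Suc M)"]
    by (force simp del: prod.cl_ivl_Suc)
  hence "poly ?T (mu k) = y k" if "k \<in> {1..Suc (Suc M)}" for k
    using that T(2) node_poly_root[of k "Suc M" mu] by (cases "k = Suc (Suc M)") auto
  moreover have "degree ?T < Suc (Suc M)"
    using T(1) node_poly_monic(1)[of mu "Suc M"]
    by (intro degree_add_less) (auto intro: le_less_trans[OF degree_smult_le])
  ultimately show ?case by blast
qed

text \<open>
  The numbers \<open>b\<^sub>n\<^sub>-\<^sub>1\<^sup>2 R(\<mu>\<^sub>k)\<close>, with \<open>R\<close> the characteristic polynomial of the leading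
  \<open>(n - 2) \<times> (n - 2)\<close> block. Up to the factors \<open>P'(\<mu>\<^sub>k)\<close>, where \<open>P\<close> is the characteristic polynomial
  of the block of size \<open>n - 1\<close>, these are \<open>b\<^sub>n\<^sub>-\<^sub>1\<^sup>2\<close> times the squared last components of the
  normalized eigenvectors of that block. They are read off from the matrix entries, because the
  sequences \<open>c\<close> and \<open>b\<close> are not determined by the matrix beyond its size; restricting the domain makes
  them an element of a dependent product.
\<close>
definition last_weights :: "nat \<Rightarrow> (nat \<Rightarrow> real) \<Rightarrow> complex mat \<Rightarrow> nat \<Rightarrow> real" where
  "last_weights n mu J = (\<lambda>k\<in>{1..n - 1}. poly (smult (Re (J $$ (n - 1, n - 2)) ^ 2)
     (jacpoly (\<lambda>i. Re (J $$ (i - 1, i - 1))) (\<lambda>i. Re (J $$ (i, i - 1))) (n - 2))) (mu k))"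

lemma last_weights_Jhat_mat:
  assumes "k \<in> {1..Suc M}"
  shows "last_weights (Suc (Suc M)) mu (Jhat_mat (Suc (Suc M)) c b an bn) k =
    poly (smult (b (Suc M) ^ 2) (jacpoly c b M)) (mu k)"
proof -
  let ?J = "Jhat_mat (Suc (Suc M)) c b an bn"
  have "jacpoly (\<lambda>i. Re (?J $$ (i - 1, i - 1))) (\<lambda>i. Re (?J $$ (i, i - 1))) M = jacpoly c b M"
    by (rule jacpoly_cong) (auto simp: Jhat_mat_def)
  moreover have "Re (?J $$ (Suc M, M)) = b (Suc M)" by (simp add: Jhat_mat_def)
  ultimately show ?thesis using assms by (simp add: last_weights_def)
qed

lemma Jhat_mat_cong:
  assumes "\<And>i. i \<in> {1..Suc M} \<Longrightarrow> c i = c' i \<and> b i = b' i"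
  shows "Jhat_mat (Suc (Suc M)) c b an bn = Jhat_mat (Suc (Suc M)) c' b' an bn"
  unfolding Jhat_mat_def using assms by (intro cong_mat) auto

text \<open>
  A normalized matrix with the given spectral data amounts to a choice of one root of each quadratic
  equation. Given the choice, interpolation yields the polynomial \<open>b\<^sub>n\<^sub>-\<^sub>1\<^sup>2 R\<close>, and the inverse
  problem yields the leading block together with \<open>b\<^sub>n\<^sub>-\<^sub>1\<close>; then \<open>b\<^sub>n\<close> is forced by the product \<open>\<beta>\<close> and
  \<open>a\<^sub>n\<close> by the trace. The sign assumption makes every root have the alternating sign that the inverse
  problem asks for.
\<close>
lemma last_weights_bij_betw:
  fixes mu :: "nat \<Rightarrow> real" and lam :: "nat \<Rightarrow> complex"
  assumes M: "1 \<le> M" and mu: "strict_mono_on {1..Suc M} mu" and \<beta>: "\<beta> \<noteq> 0"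
  defines "n \<equiv> Suc (Suc M)"
  defines "s \<equiv> \<lambda>k. Re (chi n lam (of_real (mu k))) + 2 * Re \<beta>"
  assumes real: "\<And>k. k \<in> {1..Suc M} \<Longrightarrow> chi n lam (of_real (mu k)) \<in> \<real>"
    and sign: "\<And>k. k \<in> {1..Suc M} \<Longrightarrow> (-1) ^ (Suc M - k) * s k < 0"
  shows "bij_betw (last_weights n mu) (spectral_matrices n lam mu \<beta> \<inter> Jhat_class_pos n)
    (\<Pi>\<^sub>E k\<in>{1..Suc M}. {y. y ^ 2 + s k * y + cmod \<beta> ^ 2 = 0})"
proof (rule bij_betw_imageI)
  note inj = strict_mono_on_imp_inj_on[OF mu]
  note iff = spectral_matrices_Jhat_iff[OF M inj, where lam = lam and \<beta> = \<beta>, folded n_def]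
  have pos_cases: "\<exists>c b an bn. J = Jhat_mat n c b an bn \<and> bn \<noteq> 0 \<and> (\<forall>i \<in> {1..Suc M}. b i > 0)"
    if "J \<in> Jhat_class_pos n" for J
    using that unfolding Jhat_class_pos_def n_def by fastforce
  show "inj_on (last_weights n mu) (spectral_matrices n lam mu \<beta> \<inter> Jhat_class_pos n)"
  proof (rule inj_onI)
    fix J J'
    assume J: "J \<in> spectral_matrices n lam mu \<beta> \<inter> Jhat_class_pos n"
      and J': "J' \<in> spectral_matrices n lam mu \<beta> \<inter> Jhat_class_pos n"
      and eq: "last_weights n mu J = last_weights n mu J'"
    obtain c b an bn where j: "J = Jhat_mat n c b an bn" "bn \<noteq> 0" "\<forall>i \<in> {1..Suc M}. b i > 0"
      using pos_cases J by blast
    obtain c' b' an' bn' where j': "J' = Jhat_mat n c' b' an' bn'" "bn' \<noteq> 0" "\<forall>i \<in> {1..Suc M}. b' i > 0"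
      using pos_cases J' by blast
    have d: "of_real (\<Prod>i = 1..Suc M. b i) * bn = \<beta>" "jacpoly c b (Suc M) = node_poly mu (Suc M)"
      "an = (\<Sum>j = 1..n. lam j) - of_real (\<Sum>k = 1..Suc M. mu k)"
      using J iff[of bn c b an] j by auto
    have d': "of_real (\<Prod>i = 1..Suc M. b' i) * bn' = \<beta>" "jacpoly c' b' (Suc M) = node_poly mu (Suc M)"
      "an' = (\<Sum>j = 1..n. lam j) - of_real (\<Sum>k = 1..Suc M. mu k)"
      using J' iff[of bn' c' b' an'] j' by auto
    have "smult (b (Suc M) ^ 2) (jacpoly c b M) = smult (b' (Suc M) ^ 2) (jacpoly c' b' M)"
    proof (rule poly_eq_on_nodes[OF inj])
      fix k assume k: "k \<in> {1..Suc M}"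
      show "poly (smult (b (Suc M) ^ 2) (jacpoly c b M)) (mu k) = poly (smult (b' (Suc M) ^ 2) (jacpoly c' b' M)) (mu k)"
        using fun_cong[OF eq, of k] unfolding j(1) j'(1) n_def last_weights_Jhat_mat[OF k] .
    qed (auto intro: le_less_trans[OF degree_smult_le] simp: degree_jacpoly)
    hence cb: "\<forall>i\<in>{1..Suc M}. c i = c' i \<and> b i = b' i"
      using j(3) j'(3) d(2) d'(2) by (intro jacobi_unique) auto
    have "(\<Prod>i = 1..Suc M. b i) = (\<Prod>i = 1..Suc M. b' i)" using cb by (intro prod.cong) auto
    hence "of_real (\<Prod>i = 1..Suc M. b i) * bn = of_real (\<Prod>i = 1..Suc M. b i) * bn'"
      using d(1) d'(1) by (simp only:)
    moreover have "complex_of_real (\<Prod>i = 1..Suc M. b i) \<noteq> 0" using d(1) \<beta> by auto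
    ultimately have "bn = bn'" using mult_left_cancel by blast
    thus "J = J'" unfolding j(1) j'(1) using d(3) d'(3) Jhat_mat_cong[of M c c' b b'] cb by (simp add: n_def)
  qed
  show "last_weights n mu ` (spectral_matrices n lam mu \<beta> \<inter> Jhat_class_pos n) =
    (\<Pi>\<^sub>E k\<in>{1..Suc M}. {y. y ^ 2 + s k * y + cmod \<beta> ^ 2 = 0})" (is "_ = ?R")
  proof (intro equalityI image_subsetI subsetI)
    fix J assume J: "J \<in> spectral_matrices n lam mu \<beta> \<inter> Jhat_class_pos n"
    obtain c b an bn where j: "J = Jhat_mat n c b an bn" "bn \<noteq> 0" "\<forall>i \<in> {1..Suc M}. b i > 0"
      using pos_cases J by blast
    have d: "of_real (\<Prod>i = 1..Suc M. b i) * bn = \<beta>" "jacpoly c b (Suc M) = node_poly mu (Suc M)"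
      "\<And>k. k \<in> {1..Suc M} \<Longrightarrow> chi n lam (of_real (mu k)) = of_real (- poly (corner_poly c b bn M) (mu k))"
      using J iff[of bn c b an] j by auto
    show "last_weights n mu J \<in> ?R"
    proof (rule PiE_I)
      fix k assume k: "k \<in> {1..Suc M}"
      have root: "poly (jacpoly c b (Suc M)) (mu k) = 0" unfolding d(2) by (rule node_poly_root[OF k])
      obtain z where z: "poly (corner_poly c b bn M) (mu k) = last_weights n mu J k + z + 2 * Re \<beta>"
        "last_weights n mu J k * z = cmod \<beta> ^ 2"
        using corner_poly_at_root[OF M root d(1)] unfolding j(1) n_def last_weights_Jhat_mat[OF k] by metis
      have "s k = - (last_weights n mu J k + z)" unfolding s_def d(3)[OF k] z(1) by simp
      hence "last_weights n mu J k ^ 2 + s k * last_weights n mu J k + last_weights n mu J k * z = 0"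
        by (simp only:) (simp add: power2_eq_square algebra_simps)
      thus "last_weights n mu J k \<in> {y. y ^ 2 + s k * y + cmod \<beta> ^ 2 = 0}"
        by (simp add: z(2))
    qed (auto simp: last_weights_def n_def)
  next
    fix y assume y: "y \<in> ?R"
    have root: "y k ^ 2 + s k * y k + cmod \<beta> ^ 2 = 0" if "k \<in> {1..Suc M}" for k
      using y that by auto
    have y_sign: "(-1) ^ (Suc M - k) * y k > 0" if k: "k \<in> {1..Suc M}" for k
    proof -
      \<comment> \<open>A root of \<open>t\<^sup>2 + s t + B\<^sup>2\<close> with \<open>B \<noteq> 0\<close> has the sign opposite to \<open>s\<close>.\<close>
      have "(y k * s k) < 0"
      proof -
        have "cmod \<beta> ^ 2 > 0" using \<beta> by simp
        thus ?thesis using root[OF k] by (smt (verit) zero_le_power2 mult.commute)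
      qed
      moreover have "((-1) ^ (Suc M - k) * y k) * ((-1) ^ (Suc M - k) * s k)
          = ((-1) ^ (Suc M - k) * (-1) ^ (Suc M - k)) * (y k * s k)" by (simp only: mult_ac)
      hence "((-1) ^ (Suc M - k) * y k) * ((-1) ^ (Suc M - k) * s k) = y k * s k"
        by (simp flip: power_mult_distrib)
      ultimately show ?thesis using sign[OF k] by (smt (verit) mult_nonpos_nonpos)
    qed
    obtain T where T: "degree T < Suc M" "\<And>k. k \<in> {1..Suc M} \<Longrightarrow> poly T (mu k) = y k"
      using newton_interpolation[OF inj, of y] by auto
    obtain c b where cb: "\<forall>i\<in>{1..Suc M}. b i > 0" "jacpoly c b (Suc M) = node_poly mu (Suc M)"
      "smult (b (Suc M) ^ 2) (jacpoly c b M) = T"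
      using jacobi_realization[OF _ mu T(1)] T(2) y_sign by auto
    let ?B = "complex_of_real (\<Prod>i = 1..Suc M. b i)"
    have "(\<Prod>i = 1..Suc M. b i) > 0" using cb(1) by (intro prod_pos) auto
    hence "(\<Prod>i = 1..Suc M. b i) \<noteq> 0" by (rule less_imp_neq[THEN not_sym])
    hence B: "?B \<noteq> 0" by (simp only: of_real_eq_0_iff not_False_eq_True)
    define bn where "bn = \<beta> / ?B"
    define an where "an = (\<Sum>j = 1..n. lam j) - of_real (\<Sum>k = 1..Suc M. mu k)"
    have bn: "?B * bn = \<beta>" "bn \<noteq> 0" using B \<beta> by (simp_all add: bn_def del: prod.cl_ivl_Suc)
    let ?J = "Jhat_mat n c b an bn"
    have "chi n lam (of_real (mu k)) = of_real (- poly (corner_poly c b bn M) (mu k))" if k: "k \<in> {1..Suc M}" for k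
    proof -
      have "poly (jacpoly c b (Suc M)) (mu k) = 0" unfolding cb(2) by (rule node_poly_root[OF k])
      from corner_poly_at_root[OF M this bn(1)] obtain z where
        z: "poly (corner_poly c b bn M) (mu k) = y k + z + 2 * Re \<beta>" "y k * z = cmod \<beta> ^ 2"
        unfolding cb(3) T(2)[OF k] by metis
      \<comment> \<open>As \<open>y k * z\<close> is the constant term of the quadratic, \<open>z\<close> is its other root.\<close>
      have "y k * (y k + s k + z) = 0" using root[OF k] z(2) by (simp add: power2_eq_square algebra_simps)
      moreover have "y k \<noteq> 0" using y_sign[OF k] by auto
      ultimately have "Re (chi n lam (of_real (mu k))) = - poly (corner_poly c b bn M) (mu k)"
        unfolding z(1) by (simp add: s_def)
      thus ?thesis using real[OF k] by (metis of_real_Re)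
    qed
    hence "?J \<in> spectral_matrices n lam mu \<beta>"
      using iff[OF bn(2), of c b an] bn(1) cb(2) an_def by blast
    moreover have "?J \<in> Jhat_class_pos n"
      unfolding Jhat_class_pos_def using bn(2) cb(1) by (auto simp: n_def)
    moreover have "y = last_weights n mu ?J"
    proof
      fix k show "y k = last_weights n mu ?J k"
      proof (cases "k \<in> {1..Suc M}")
        case True
        thus ?thesis unfolding n_def by (simp only: last_weights_Jhat_mat cb(3) T(2))
      next
        case False
        thus ?thesis using y by (auto simp: last_weights_def n_def PiE_def extensional_def)
      qed
    qed
    ultimately show "y \<in> last_weights n mu ` (spectral_matrices n lam mu \<beta> \<inter> Jhat_class_pos n)" by blast
  qed
qed

section \<open>Normalization by sign changes\<close>

lemma spectral_matrices_cases:
  fixes mu :: "nat \<Rightarrow> real"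
  assumes "J \<in> spectral_matrices (Suc (Suc M)) lam mu \<beta>" "1 \<le> M" "inj_on mu {1..Suc M}" "\<beta> \<noteq> 0"
  obtains c b an bn where "J = Jhat_mat (Suc (Suc M)) c b an bn" "bn \<noteq> 0" "\<And>i. i \<in> {1..Suc M} \<Longrightarrow> b i \<noteq> 0"
proof -
  from assms(1) obtain c b an bn where J: "J = Jhat_mat (Suc (Suc M)) c b an bn" "bn \<noteq> 0"
    unfolding spectral_matrices_def Jhat_class_def by blast
  hence "complex_of_real (\<Prod>i = 1..Suc M. b i) * bn = \<beta>"
    using spectral_matrices_Jhat_iff[OF assms(2,3) J(2)] assms(1) by blast
  hence "(\<Prod>i = 1..Suc M. b i) \<noteq> 0" using assms(4) by auto
  hence "b i \<noteq> 0" if "i \<in> {1..Suc M}" for i using that prod_zero_iff[of "{1..Suc M}" b] by auto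
  thus ?thesis using that J by blast
qed

text \<open>
  Conjugating by the partial products of the signs of \<open>b\<^sub>1, b\<^sub>2, \<dots>\<close> makes every off-diagonal entry
  positive and multiplies the corner entry by the sign of \<open>b\<^sub>1 \<cdots> b\<^sub>n\<^sub>-\<^sub>1\<close>, which leaves \<open>\<beta>\<close> unchanged.
  The spectra survive because they depend on \<open>b\<^sub>i\<close> only through squares and through \<open>\<beta>\<close>.
\<close>
lemma sign_normalization:
  fixes mu :: "nat \<Rightarrow> real"
  assumes "J \<in> spectral_matrices (Suc (Suc M)) lam mu \<beta>" "1 \<le> M" "inj_on mu {1..Suc M}" "\<beta> \<noteq> 0"
  shows "\<exists>J' \<in> spectral_matrices (Suc (Suc M)) lam mu \<beta> \<inter> Jhat_class_pos (Suc (Suc M)).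
    (J, J') \<in> sign_equiv (Suc (Suc M))"
proof -
  obtain c b an bn where J: "J = Jhat_mat (Suc (Suc M)) c b an bn" "bn \<noteq> 0"
    and b: "\<And>i. i \<in> {1..Suc M} \<Longrightarrow> b i \<noteq> 0"
    using spectral_matrices_cases[OF assms] by blast
  note iff = spectral_matrices_Jhat_iff[OF assms(2,3), where lam = lam and \<beta> = \<beta>]
  define s where "s i = (\<Prod>j = 1..i. sgn (b j))" for i
  have s: "s i = 1 \<or> s i = - 1" if "i \<le> Suc M" for i
    using that
  proof (induction i)
    case (Suc i)
    have "sgn (b (Suc i)) = 1 \<or> sgn (b (Suc i)) = - 1" using b[of "Suc i"] Suc.prems by (auto simp: sgn_if)
    thus ?case using Suc by (auto simp: s_def)
  qed (simp add: s_def)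
  have s_sq: "s i * s i = 1" if "i \<le> Suc M" for i using s[OF that] by auto
  have step: "s i * b (Suc i) * s (Suc i) = \<bar>b (Suc i)\<bar>" if "i \<le> M" for i
  proof -
    have "s i * b (Suc i) * s (Suc i) = (s i * s i) * (sgn (b (Suc i)) * b (Suc i))"
      by (simp add: s_def mult_ac)
    thus ?thesis using s_sq[of i] that by (simp add: sgn_mult_self_eq abs_sgn mult.commute)
  qed
  let ?J' = "Jhat_mat (Suc (Suc M)) c (\<lambda>i. \<bar>b i\<bar>) an (of_real (s (Suc M)) * bn)"
  have bn': "of_real (s (Suc M)) * bn \<noteq> 0" using J(2) s[of "Suc M"] by auto
  have "(\<Prod>i = 1..Suc M. \<bar>b i\<bar>) = (\<Prod>i = 1..Suc M. b i) * s (Suc M)"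
    unfolding s_def prod.distrib[symmetric] by (simp add: abs_sgn)
  hence "(\<Prod>i = 1..Suc M. \<bar>b i\<bar>) * s (Suc M) = (\<Prod>i = 1..Suc M. b i)"
    using s_sq[of "Suc M"] by (simp add: mult.assoc)
  hence prod: "complex_of_real (\<Prod>i = 1..Suc M. \<bar>b i\<bar>) * (of_real (s (Suc M)) * bn)
      = of_real (\<Prod>i = 1..Suc M. b i) * bn"
    unfolding mult.assoc[symmetric] of_real_mult[symmetric] by simp
  have jac: "jacpoly c (\<lambda>i. \<bar>b i\<bar>) k = jacpoly c b k" for c b k by (rule jacpoly_cong) auto
  have norm: "cmod (of_real (s (Suc M)) * bn) = cmod bn" using s[of "Suc M"] by auto
  have "corner_poly c (\<lambda>i. \<bar>b i\<bar>) (of_real (s (Suc M)) * bn) M = corner_poly c b bn M"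
    unfolding corner_poly_def prod norm jac jac[of "\<lambda>i. c (Suc i)" "\<lambda>i. b (Suc i)"] by simp
  hence "?J' \<in> spectral_matrices (Suc (Suc M)) lam mu \<beta>"
    using assms(1) unfolding J(1) iff[OF J(2)] iff[OF bn'] prod jac by simp
  moreover have "?J' \<in> Jhat_class_pos (Suc (Suc M))"
    unfolding Jhat_class_pos_def using bn' b by (auto intro!: exI)
  moreover have "(J, ?J') \<in> sign_equiv (Suc (Suc M))"
    unfolding sign_equiv_def
  proof (intro CollectI case_prodI exI conjI)
    let ?s = "\<lambda>i. complex_of_real (s i)"
    show "\<forall>i<Suc (Suc M). ?s i = 1 \<or> ?s i = - 1"
    proof (intro allI impI)
      fix i assume "i < Suc (Suc M)"
      hence "s i = 1 \<or> s i = - 1" by (intro s) simp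
      thus "?s i = 1 \<or> ?s i = - 1" by (elim disjE) simp_all
    qed
    have cstep: "?s i * of_real (b (Suc i)) * ?s (Suc i) = of_real \<bar>b (Suc i)\<bar>"
      "?s (Suc i) * of_real (b (Suc i)) * ?s i = of_real \<bar>b (Suc i)\<bar>" if "i \<le> M" for i
      unfolding of_real_mult[symmetric] of_real_eq_iff using step[OF that] by (simp_all add: mult_ac)
    have csq: "?s i * z * ?s i = z" if "i \<le> Suc M" for i z
    proof -
      have "?s i * ?s i = 1" unfolding of_real_mult[symmetric] s_sq[OF that] by simp
      thus ?thesis by (metis mult.commute mult.left_commute mult_1)
    qed
    have s0: "s 0 = 1" by (simp add: s_def)
    show "?J' = mat (Suc (Suc M)) (Suc (Suc M)) (\<lambda>(i, j). ?s i * J $$ (i, j) * ?s j)"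
      unfolding J(1) Jhat_mat_def using assms(2)
      by (intro eq_matI) (auto simp: cstep csq s0 less_Suc_eq_le)
  qed
  ultimately show ?thesis by blast
qed

lemma sign_equiv_classes_eq:
  assumes "(A, B) \<in> sign_equiv n" "A \<in> carrier_mat n n"
  shows "sign_equiv n `` {A} = sign_equiv n `` {B}"
proof -
  from assms(1) obtain s where s: "\<forall>i<n. s i = 1 \<or> s i = (-1::complex)"
    and B: "B = mat n n (\<lambda>(i, j). s i * A $$ (i, j) * s j)"
    unfolding sign_equiv_def by blast
  have sq: "s i * s i = 1" if "i < n" for i using s that by fastforce
  have mul: "\<forall>i<n. t i * s i = 1 \<or> t i * s i = (-1::complex)" if "\<forall>i<n. t i = 1 \<or> t i = (-1::complex)" for t
    using that s by fastforce
  have A: "t i * A $$ (i, j) * t j = (t i * s i) * B $$ (i, j) * (t j * s j)" if "i < n" "j < n" for i j t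
  proof -
    have "(t i * s i) * B $$ (i, j) * (t j * s j) = (s i * s i) * (s j * s j) * (t i * A $$ (i, j) * t j)"
      using that by (simp add: B mult_ac)
    thus ?thesis by (simp only: sq[OF that(1)] sq[OF that(2)] mult_1)
  qed
  have B': "t i * B $$ (i, j) * t j = (t i * s i) * A $$ (i, j) * (t j * s j)" if "i < n" "j < n" for i j t
    using that by (simp add: B mult_ac)
  have 1: "C \<in> sign_equiv n `` {B}" if "C \<in> sign_equiv n `` {A}" for C
  proof -
    from that obtain t where t: "\<forall>i<n. t i = 1 \<or> t i = (-1::complex)"
      "C = mat n n (\<lambda>(i, j). t i * A $$ (i, j) * t j)" unfolding sign_equiv_def by blast
    have "C = mat n n (\<lambda>(i, j). (t i * s i) * B $$ (i, j) * (t j * s j))"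
      unfolding t(2) by (rule eq_matI) (simp_all add: A)
    with mul[OF t(1)] show ?thesis unfolding sign_equiv_def by (auto intro!: exI[of _ "\<lambda>i. t i * s i"])
  qed
  have 2: "C \<in> sign_equiv n `` {A}" if "C \<in> sign_equiv n `` {B}" for C
  proof -
    from that obtain t where t: "\<forall>i<n. t i = 1 \<or> t i = (-1::complex)"
      "C = mat n n (\<lambda>(i, j). t i * B $$ (i, j) * t j)" unfolding sign_equiv_def by blast
    have "C = mat n n (\<lambda>(i, j). (t i * s i) * A $$ (i, j) * (t j * s j))"
      unfolding t(2) by (rule eq_matI) (simp_all add: B')
    with mul[OF t(1)] show ?thesis unfolding sign_equiv_def by (auto intro!: exI[of _ "\<lambda>i. t i * s i"])
  qed
  from 1 2 show ?thesis by blast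
qed

lemma sign_equiv_refl:
  assumes "A \<in> carrier_mat n n"
  shows "(A, A) \<in> sign_equiv n"
  unfolding sign_equiv_def
  by (intro CollectI case_prodI exI[of _ "\<lambda>_. 1"] conjI) (use assms in auto)

text \<open>
  Positive entries next to the diagonal force neighbouring signs to agree, so the conjugating
  diagonal matrix is \<open>1\<close> or \<open>-1\<close>.
\<close>
lemma sign_equiv_pos_eq:
  assumes "(A, B) \<in> sign_equiv n" "A \<in> Jhat_class_pos n" "B \<in> Jhat_class_pos n"
  shows "A = B"
proof -
  obtain c b an bn where A: "A = Jhat_mat n c b an bn" "\<forall>k \<in> {1..n - 1}. b k > 0"
    using assms(2) unfolding Jhat_class_pos_def by blast
  obtain c' b' an' bn' where B: "B = Jhat_mat n c' b' an' bn'" "\<forall>k \<in> {1..n - 1}. b' k > 0"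
    using assms(3) unfolding Jhat_class_pos_def by blast
  obtain s where s: "\<forall>i<n. s i = 1 \<or> s i = (-1::complex)"
    and BA: "B = mat n n (\<lambda>(i, j). s i * A $$ (i, j) * s j)"
    using assms(1) unfolding sign_equiv_def by blast
  have const: "s i = s 0" if "i < n" for i
    using that
  proof (induction i)
    case (Suc i)
    have "B $$ (i, Suc i) = s i * A $$ (i, Suc i) * s (Suc i)" using Suc.prems by (simp add: BA)
    hence "complex_of_real (b' (Suc i)) = s i * of_real (b (Suc i)) * s (Suc i)"
      using Suc.prems by (simp add: A(1) B(1) Jhat_mat_def)
    hence *: "b' (Suc i) = Re (s i * of_real (b (Suc i)) * s (Suc i))" by (metis Re_complex_of_real)
    have "b (Suc i) > 0" "b' (Suc i) > 0" using A(2) B(2) Suc.prems by auto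
    moreover have "s i = 1 \<or> s i = - 1" "s (Suc i) = 1 \<or> s (Suc i) = - 1" using s Suc.prems by auto
    ultimately have "s (Suc i) = s i" using * by auto
    thus ?case using Suc by simp
  qed simp
  have entry: "s i * A $$ (i, j) * s j = A $$ (i, j)" if "i < n" "j < n" for i j
  proof -
    have "s 0 = 1 \<or> s 0 = - 1" using s that(1) by simp
    thus ?thesis unfolding const[OF that(1)] const[OF that(2)] by (elim disjE) simp_all
  qed
  have "B = mat n n (\<lambda>(i, j). A $$ (i, j))" unfolding BA by (intro eq_matI) (simp_all add: entry)
  also have "\<dots> = A" by (intro eq_matI) (auto simp: A(1) Jhat_mat_def)
  finally show ?thesis ..
qed

lemma card_sign_equiv_classes:
  assumes "S \<subseteq> carrier_mat n n" "\<And>J. J \<in> S \<Longrightarrow> \<exists>J' \<in> S \<inter> Jhat_class_pos n. (J, J') \<in> sign_equiv n"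
  shows "card (S // sign_equiv n) = card (S \<inter> Jhat_class_pos n)"
proof -
  have "bij_betw (\<lambda>J. sign_equiv n `` {J}) (S \<inter> Jhat_class_pos n) (S // sign_equiv n)"
  proof (rule bij_betw_imageI)
    show "inj_on (\<lambda>J. sign_equiv n `` {J}) (S \<inter> Jhat_class_pos n)"
    proof (rule inj_onI)
      fix A B assume A: "A \<in> S \<inter> Jhat_class_pos n" and B: "B \<in> S \<inter> Jhat_class_pos n"
        and eq: "sign_equiv n `` {A} = sign_equiv n `` {B}"
      have "(B, B) \<in> sign_equiv n" using B assms(1) by (intro sign_equiv_refl) auto
      hence "(A, B) \<in> sign_equiv n" using eq by blast
      thus "A = B" using A B sign_equiv_pos_eq by blast
    qed
    show "(\<lambda>J. sign_equiv n `` {J}) ` (S \<inter> Jhat_class_pos n) = S // sign_equiv n"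
    proof (intro equalityI subsetI)
      fix X assume "X \<in> S // sign_equiv n"
      then obtain J where J: "J \<in> S" "X = sign_equiv n `` {J}" by (rule quotientE)
      then obtain J' where J': "J' \<in> S \<inter> Jhat_class_pos n" "(J, J') \<in> sign_equiv n" using assms(2) by blast
      have "X = sign_equiv n `` {J'}" using sign_equiv_classes_eq[OF J'(2)] J assms(1) by blast
      thus "X \<in> (\<lambda>J. sign_equiv n `` {J}) ` (S \<inter> Jhat_class_pos n)" using J' by blast
    qed (auto intro: quotientI)
  qed
  thus ?thesis by (simp add: bij_betw_same_card)
qed

section \<open>Necessary and sufficient conditions, and the count\<close>

text \<open>
  The pair of the quadratic equation for an arbitrary matrix with the given data, whatever the signs
  of its off-diagonal entries. The sign of \<open>y\<close> is that of the derivative of the node polynomial.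
\<close>
lemma chi_at_root:
  fixes mu :: "nat \<Rightarrow> real"
  assumes J: "J \<in> spectral_matrices (Suc (Suc M)) lam mu \<beta>" and M: "1 \<le> M"
    and mu: "strict_mono_on {1..Suc M} mu" and \<beta>: "\<beta> \<noteq> 0" and k: "k \<in> {1..Suc M}"
  obtains y z where "chi (Suc (Suc M)) lam (of_real (mu k)) = of_real (- (y + z) - 2 * Re \<beta>)"
    "y * z = cmod \<beta> ^ 2" "(-1) ^ (Suc M - k) * y > 0"
proof -
  note inj = strict_mono_on_imp_inj_on[OF mu]
  obtain c b an bn where j: "J = Jhat_mat (Suc (Suc M)) c b an bn" "bn \<noteq> 0"
    and b: "\<And>i. i \<in> {1..Suc M} \<Longrightarrow> b i \<noteq> 0"
    using spectral_matrices_cases[OF J M inj \<beta>] by blast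
  have d: "of_real (\<Prod>i = 1..Suc M. b i) * bn = \<beta>" "jacpoly c b (Suc M) = node_poly mu (Suc M)"
    "chi (Suc (Suc M)) lam (of_real (mu k)) = of_real (- poly (corner_poly c b bn M) (mu k))"
    using J k unfolding j(1) spectral_matrices_Jhat_iff[OF M inj j(2)] by blast+
  have "poly (jacpoly c b (Suc M)) (mu k) = 0" unfolding d(2) by (rule node_poly_root[OF k])
  from corner_poly_at_root[OF M this d(1)] obtain z where z:
    "poly (corner_poly c b bn M) (mu k) = poly (smult (b (Suc M) ^ 2) (jacpoly c b M)) (mu k) + z + 2 * Re \<beta>"
    "poly (smult (b (Suc M) ^ 2) (jacpoly c b M)) (mu k) * z = cmod \<beta> ^ 2" by blast
  show ?thesis
  proof (rule that)
    show "chi (Suc (Suc M)) lam (of_real (mu k)) =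
      of_real (- (poly (smult (b (Suc M) ^ 2) (jacpoly c b M)) (mu k) + z) - 2 * Re \<beta>)"
      unfolding d(3) z(1) by simp
  qed (use z(2) jacpoly_minor_sign[OF mu d(2) b k] in auto)
qed

lemma Im_last_entry:
  fixes mu :: "nat \<Rightarrow> real"
  assumes "J \<in> spectral_matrices (Suc (Suc M)) lam mu \<beta>" "1 \<le> M" "inj_on mu {1..Suc M}"
  shows "Im (J $$ (Suc M, Suc M)) = (\<Sum>j = 1..Suc (Suc M). Im (lam j))"
proof -
  from assms(1) obtain c b an bn where J: "J = Jhat_mat (Suc (Suc M)) c b an bn" "bn \<noteq> 0"
    unfolding spectral_matrices_def Jhat_class_def by blast
  hence "an = (\<Sum>j = 1..Suc (Suc M). lam j) - of_real (\<Sum>k = 1..Suc M. mu k)"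
    using assms(1) spectral_matrices_Jhat_iff[OF assms(2,3) J(2)] by blast
  moreover have "J $$ (Suc M, Suc M) = an" by (simp add: J(1) Jhat_mat_def)
  ultimately show ?thesis by (simp only: minus_complex.sel Im_sum Im_complex_of_real diff_zero)
qed

lemma abs_Re_less_cmod:
  assumes "\<beta> \<notin> \<real>"
  shows "\<bar>Re \<beta>\<bar> < cmod \<beta>"
proof -
  have "Im \<beta> \<noteq> 0" using assms complex_is_Real_iff by blast
  hence "\<bar>Re \<beta>\<bar> ^ 2 < cmod \<beta> ^ 2" by (simp add: cmod_power2)
  thus ?thesis by (rule power2_less_imp_less) simp
qed

theorem theorem4p2:
  fixes n :: nat and \<beta> :: complex and mu :: "nat \<Rightarrow> real" and lam :: "nat \<Rightarrow> complex"
  assumes "n \<ge> 3"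
    and "\<beta> \<notin> \<real>"
    and "strict_mono_on {1..n - 1} mu"
    and "\<And>j. j \<in> {1..n} \<Longrightarrow> Im (lam j) > 0"
  defines "conditions \<equiv> (\<forall>k \<in> {1..n - 1}.
      (chi n lam (of_real (mu k)) \<in> \<real> \<and> (-1) ^ (n - k) * Re (chi n lam (of_real (mu k))) > 0) \<and>
      cmod (chi n lam (of_real (mu k)) + 2 * of_real (Re \<beta>)) \<ge> 2 * cmod \<beta>)"
  shows "((\<exists>J \<in> Jhat_class n.
            Im (J $$ (n - 1, n - 1)) > 0 \<and>
            offdiag_prod n J = \<beta> \<and>
            mspectrum J = image_mset lam (mset_set {1..n}) \<and>
            mspectrum (submatrix J {..<n - 1} {..<n - 1})
              = image_mset (\<lambda>k. of_real (mu k)) (mset_set {1..n - 1}))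
          \<longleftrightarrow> conditions) \<and>
         (\<forall>m. conditions \<and>
              card {k \<in> {1..n - 1}.
                cmod (chi n lam (of_real (mu k)) + 2 * of_real (Re \<beta>)) = 2 * cmod \<beta>} = m
          \<longrightarrow> card (spectral_matrices n lam mu \<beta> // sign_equiv n) = 2 ^ (n - m - 1) \<and>
              card (spectral_matrices n lam mu \<beta> \<inter> Jhat_class_pos n) = 2 ^ (n - m - 1))"
proof -
  obtain M where n: "n = Suc (Suc M)" and M: "1 \<le> M"
    using assms(1) by (metis Suc_le_D Suc_le_mono numeral_3_eq_3 One_nat_def)
  have mu: "strict_mono_on {1..Suc M} mu" using assms(3) by (simp add: n)
  note inj = strict_mono_on_imp_inj_on[OF mu]
  note Re_less = abs_Re_less_cmod[OF assms(2)]
  have \<beta>: "\<beta> \<noteq> 0" "cmod \<beta> > 0" using assms(2) by auto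
  let ?S = "spectral_matrices n lam mu \<beta>"
  define X where "X k = Re (chi n lam (of_real (mu k)))" for k
  define s where "s k = X k + 2 * Re \<beta>" for k
  have cmod_s: "cmod (chi n lam (of_real (mu k)) + 2 * of_real (Re \<beta>)) = \<bar>s k\<bar>"
    if real: "chi n lam (of_real (mu k)) \<in> \<real>" for k
  proof -
    have "chi n lam (of_real (mu k)) = of_real (X k)" using real by (simp add: X_def)
    hence "chi n lam (of_real (mu k)) + 2 * of_real (Re \<beta>) = of_real (s k)" by (simp add: s_def)
    thus ?thesis by (simp only: norm_of_real)
  qed
  have sgn: "(-1) ^ (Suc M - k) = (1::real) \<or> (-1) ^ (Suc M - k) = (-1::real)" for k
    by (simp add: minus_one_power_iff)
  have flip: "(-1) ^ (n - k) * x = - ((-1) ^ (Suc M - k) * (x::real))" if "k \<in> {1..Suc M}" for k x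
    using that by (simp add: n Suc_diff_le)
  have nec: conditions if J: "J \<in> ?S" for J
    unfolding conditions_def
  proof (intro ballI)
    fix k assume "k \<in> {1..n - 1}"
    hence k: "k \<in> {1..Suc M}" by (simp add: n)
    from chi_at_root[OF J[unfolded n] M mu \<beta>(1) k] obtain y z where
      yz: "chi n lam (of_real (mu k)) = of_real (- (y + z) - 2 * Re \<beta>)"
        "y * z = cmod \<beta> ^ 2" "(-1) ^ (Suc M - k) * y > 0" unfolding n by blast
    have real: "chi n lam (of_real (mu k)) \<in> \<real>" unfolding yz(1) by (rule Reals_of_real)
    have s: "s k = - (y + z)" unfolding s_def X_def yz(1) by simp
    have ge: "\<bar>s k\<bar> \<ge> 2 * cmod \<beta>"
      using sum_ge_of_product_eq_square(1)[OF yz(2) \<beta>(2)] by (simp add: s)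
    have "(-1) ^ (Suc M - k) * s k < 0"
      using sum_ge_of_product_eq_square(2)[OF yz(2) \<beta>(2) yz(3)] by (simp add: s algebra_simps)
    \<comment> \<open>Passing from \<open>s k = X k + 2 Re \<beta>\<close> to \<open>X k\<close> keeps the sign, since \<open>2 |Re \<beta>| < 2 |\<beta>| \<le> |s k|\<close>.\<close>
    hence "(-1) ^ (Suc M - k) * X k < 0"
      using sgn[of k] ge Re_less unfolding s_def by auto
    thus "(chi n lam (of_real (mu k)) \<in> \<real> \<and> (-1) ^ (n - k) * Re (chi n lam (of_real (mu k))) > 0) \<and>
      cmod (chi n lam (of_real (mu k)) + 2 * of_real (Re \<beta>)) \<ge> 2 * cmod \<beta>"
      using real ge cmod_s[OF real] flip[OF k] by (simp add: X_def)
  qed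
  let ?R = "\<lambda>k. {y. y ^ 2 + s k * y + cmod \<beta> ^ 2 = 0}"
  have bij: "bij_betw (last_weights n mu) (?S \<inter> Jhat_class_pos n) (\<Pi>\<^sub>E k\<in>{1..Suc M}. ?R k)"
    if cond: conditions
    unfolding n s_def X_def
  proof (rule last_weights_bij_betw[OF M mu \<beta>(1)])
    fix k assume k: "k \<in> {1..Suc M}"
    hence c: "chi n lam (of_real (mu k)) \<in> \<real>" "(-1) ^ (n - k) * X k > 0"
      "cmod (chi n lam (of_real (mu k)) + 2 * of_real (Re \<beta>)) \<ge> 2 * cmod \<beta>"
      using cond unfolding conditions_def X_def by (auto simp: n)
    show "chi (Suc (Suc M)) lam (of_real (mu k)) \<in> \<real>" using c(1) by (simp add: n)
    \<comment> \<open>If \<open>s k\<close> had the sign opposite to \<open>X k\<close>, then \<open>|s k| < 2 |Re \<beta>| < 2 |\<beta>|\<close>.\<close>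
    have "(-1) ^ (Suc M - k) * s k < 0"
      using sgn[of k] c(2,3) Re_less unfolding cmod_s[OF c(1)] flip[OF k] s_def by auto
    thus "(-1) ^ (Suc M - k) * (Re (chi (Suc (Suc M)) lam (of_real (mu k))) + 2 * Re \<beta>) < 0"
      by (simp add: s_def X_def n)
  qed
  have roots: "finite (?R k)" "card (?R k) = (if \<bar>s k\<bar> = 2 * cmod \<beta> then 1 else 2)"
    if cond: conditions and k: "k \<in> {1..Suc M}" for k
  proof -
    have "chi n lam (of_real (mu k)) \<in> \<real>"
      "cmod (chi n lam (of_real (mu k)) + 2 * of_real (Re \<beta>)) \<ge> 2 * cmod \<beta>"
      using cond k unfolding conditions_def by (auto simp: n)
    hence "\<bar>s k\<bar> \<ge> 2 * cmod \<beta>" by (simp only: cmod_s)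
    thus "finite (?R k)" "card (?R k) = (if \<bar>s k\<bar> = 2 * cmod \<beta> then 1 else 2)"
      using card_quadratic_roots \<beta>(2) by blast+
  qed
  have count: "card (?S \<inter> Jhat_class_pos n) = 2 ^ (n - m - 1)"
    if cond: conditions and m: "card {k \<in> {1..n - 1}.
      cmod (chi n lam (of_real (mu k)) + 2 * of_real (Re \<beta>)) = 2 * cmod \<beta>} = m" for m
  proof -
    have m': "{k \<in> {1..n - 1}. cmod (chi n lam (of_real (mu k)) + 2 * of_real (Re \<beta>)) = 2 * cmod \<beta>}
        = {k \<in> {1..Suc M}. \<bar>s k\<bar> = 2 * cmod \<beta>}" (is "_ = ?E")
      using cond cmod_s unfolding conditions_def by (auto simp: n)
    have "card (?S \<inter> Jhat_class_pos n) = card (\<Pi>\<^sub>E k\<in>{1..Suc M}. ?R k)"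
      using bij[OF cond] by (rule bij_betw_same_card)
    also have "\<dots> = (\<Prod>k\<in>{1..Suc M}. card (?R k))" by (rule card_PiE) simp
    also have "\<dots> = (\<Prod>k\<in>{1..Suc M}. if \<bar>s k\<bar> = 2 * cmod \<beta> then 1 else 2)"
      by (rule prod.cong[OF refl roots(2)[OF cond]])
    also have "\<dots> = 2 ^ card ({1..Suc M} - ?E)"
    proof -
      have "(\<Prod>k\<in>{1..Suc M}. if \<bar>s k\<bar> = 2 * cmod \<beta> then 1 else 2) = (\<Prod>k\<in>{1..Suc M} - ?E. (2::nat))"
        by (rule prod.mono_neutral_cong_right) auto
      thus ?thesis by (simp add: prod_constant)
    qed
    also have "card ({1..Suc M} - ?E) = n - m - 1"
      using m unfolding m' by (subst card_Diff_subset) (auto simp: n)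
    finally show ?thesis .
  qed
  have suf: "\<exists>J. J \<in> ?S" if cond: conditions
  proof -
    have "?R k \<noteq> {}" if "k \<in> {1..Suc M}" for k
      using roots(2)[OF cond that] by (metis card.empty zero_neq_numeral zero_neq_one)
    hence "(\<Pi>\<^sub>E k\<in>{1..Suc M}. ?R k) \<noteq> {}" unfolding PiE_eq_empty_iff by blast
    hence "last_weights n mu ` (?S \<inter> Jhat_class_pos n) \<noteq> {}"
      unfolding bij_betw_imp_surj_on[OF bij[OF cond]] .
    thus ?thesis by blast
  qed
  \<comment> \<open>The trace gives the last diagonal entry the imaginary part \<open>\<Sum> Im \<lambda>\<^sub>j\<close>.\<close>
  have "Im (J $$ (n - 1, n - 1)) > 0" if "J \<in> ?S" for J
  proof -
    have "(\<Sum>j = 1..n. Im (lam j)) > 0" using assms(1,4) by (intro sum_pos) auto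
    thus ?thesis using Im_last_entry[OF that[unfolded n] M inj] by (simp add: n del: sum.cl_ivl_Suc)
  qed
  hence "(\<exists>J \<in> Jhat_class n. Im (J $$ (n - 1, n - 1)) > 0 \<and> offdiag_prod n J = \<beta> \<and>
            mspectrum J = image_mset lam (mset_set {1..n}) \<and>
            mspectrum (submatrix J {..<n - 1} {..<n - 1})
              = image_mset (\<lambda>k. of_real (mu k)) (mset_set {1..n - 1})) \<longleftrightarrow> (\<exists>J. J \<in> ?S)"
    unfolding spectral_matrices_def by blast
  also have "\<dots> \<longleftrightarrow> conditions" using nec suf by blast
  finally have existence: "(\<exists>J \<in> Jhat_class n. Im (J $$ (n - 1, n - 1)) > 0 \<and> offdiag_prod n J = \<beta> \<and>
            mspectrum J = image_mset lam (mset_set {1..n}) \<and>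
            mspectrum (submatrix J {..<n - 1} {..<n - 1})
              = image_mset (\<lambda>k. of_real (mu k)) (mset_set {1..n - 1})) \<longleftrightarrow> conditions" .
  have "card (?S // sign_equiv n) = card (?S \<inter> Jhat_class_pos n)"
  proof (rule card_sign_equiv_classes)
    show "?S \<subseteq> carrier_mat n n"
      unfolding spectral_matrices_def Jhat_class_def by (auto simp: Jhat_mat_def)
    show "\<exists>J' \<in> ?S \<inter> Jhat_class_pos n. (J, J') \<in> sign_equiv n" if "J \<in> ?S" for J
      using sign_normalization[OF that[unfolded n] M inj \<beta>(1)] by (simp add: n)
  qed
  thus ?thesis using existence count by auto
qed

end
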